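(* Let $u_+=\begin{pmatrix}1&2&2\\0&1&2\\0&0&1\end{pmatrix}$, $u_-=\begin{pmatrix}1&0&0\\2&1&0\\2&2&1\end{pmatrix}$ and let $\Gamma_0=\langle u_+,u_-\rangle$ be the group they generate. Let $\mathcal{C}\subset\mathrm{Gr}_2(\mathbb{R}^3)$ be the circle of isotropic planes of $Q(v)=2v_1v_3-v_2^2$. There exists a continuous $\Gamma_0$-equivariant section $\zeta:\mathcal{C}\to X$ (i.e. $\zeta$ is continuous, $\Gamma_0$-equivariant and $\pi(\zeta(p))=p$ for all $p\in\mathcal{C}$). In particular, if $\mu$ is a Borel probability measure on $\mathrm{SL}_3(\mathbb{R})$ such that the group generated by $\mathrm{supp}\,\mu$ equals $\Gamma_0$, then $\zeta_*\bar\nu_{\mathrm{Gr}_2(\mathbb{R}^3)}$ is a $\mu$-stationary 1-extension of the Furstenberg measure $\bar\nu_{\mathrm{Gr}_2(\mathbb{R}^3)}$ of $\mu$ on $\mathrm{Gr}_2(\mathbb{R}^3)$.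
   Context: $X$ is the space of rank-2 discrete subgroups $\Lambda\subset\mathbb{R}^3$ identified up to scaling, a homogeneous space of $\mathrm{SL}_3(\mathbb{R})$ via the linear action, and $\pi:X\to\mathrm{Gr}_2(\mathbb{R}^3)$ sends the class of $\Lambda$ to the plane it spans. $\mathcal{C}$ is the set of planes $p$ such that the restriction of $Q$ to $p$ is degenerate; it equals the orbit $\mathrm{SO}(Q)(\mathbb{R})\cdot\mathrm{span}_{\mathbb{R}}(e_1,e_2)$. The group $\Gamma_0$ is contained in $\mathrm{SO}(Q)(\mathbb{Z})$ (with finite index) and is Zariski dense in $\mathrm{SO}(Q)(\mathbb{R})$. A probability measure $\nu$ is $\mu$-stationary if $\int g_*\nu\,d\mu(g)=\nu$. For $\mu$ whose support generates $\Gamma_0$ there is a unique $\mu$-stationary probability measure on $\mathrm{Gr}_2(\mathbb{R}^3)$, the Furstenberg measure $\bar\nu_{\mathrm{Gr}_2(\mathbb{R}^3)}$; it is supported on $\mathcal{C}$. A probability measure $\nu$ on $X$ with $\pi_*\nu=\bar\nu$ is a 1-extension of $\bar\nu$ if in the disintegration $\nu=\int\nu_p\,d\bar\nu(p)$ over $\pi$ the measure $\nu_p$ is a point mass for $\bar\nu$-almost every $p$. *)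

theory Defs
  imports "HOL-Probability.Probability" "HOL-Algebra.Generated_Groups"
begin

section \<open>Topology and measure\<close>

text \<open>The finest topology on the set \<open>Y\<close> for which \<open>f\<close>, defined on the topological space \<open>T\<close>,
  is continuous; the quotient topology when \<open>f\<close> is onto \<open>Y\<close>.\<close>

definition quotient_topology :: "'a topology \<Rightarrow> ('a \<Rightarrow> 'b) \<Rightarrow> 'b set \<Rightarrow> 'b topology" where
  "quotient_topology T f Y =
     topology (\<lambda>U. U \<subseteq> Y \<and> openin T {x \<in> topspace T. f x \<in> U})"

lemma openin_quotient_topology:
  "openin (quotient_topology T f Y) U \<longleftrightarrow> U \<subseteq> Y \<and> openin T {x \<in> topspace T. f x \<in> U}"
proof -
  have "istopology (\<lambda>U. U \<subseteq> Y \<and> openin T {x \<in> topspace T. f x \<in> U})"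
    unfolding istopology_def
  proof (intro conjI allI impI)
    fix S U assume S: "S \<subseteq> Y \<and> openin T {x \<in> topspace T. f x \<in> S}"
      and U: "U \<subseteq> Y \<and> openin T {x \<in> topspace T. f x \<in> U}"
    have "{x \<in> topspace T. f x \<in> S \<inter> U}
        = {x \<in> topspace T. f x \<in> S} \<inter> {x \<in> topspace T. f x \<in> U}" by auto
    then show "openin T {x \<in> topspace T. f x \<in> S \<inter> U}" using S U by (simp add: openin_Int)
    show "S \<inter> U \<subseteq> Y" using S by auto
  next
    fix \<K> assume K: "\<forall>K\<in>\<K>. K \<subseteq> Y \<and> openin T {x \<in> topspace T. f x \<in> K}"
    have "{x \<in> topspace T. f x \<in> \<Union>\<K>} = (\<Union>K\<in>\<K>. {x \<in> topspace T. f x \<in> K})" by auto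
    then show "openin T {x \<in> topspace T. f x \<in> \<Union>\<K>}" using K by auto
    show "\<Union>\<K> \<subseteq> Y" using K by auto
  qed
  then show ?thesis by (simp add: quotient_topology_def topology_inverse')
qed

lemma topspace_quotient_topology:
  assumes "f ` topspace T \<subseteq> Y"
  shows "topspace (quotient_topology T f Y) = Y"
proof -
  have "{x \<in> topspace T. f x \<in> Y} = topspace T" using assms by auto
  then have "openin (quotient_topology T f Y) Y" by (simp add: openin_quotient_topology)
  then show ?thesis
    by (metis openin_quotient_topology openin_subset openin_topspace subset_antisym)
qed

lemma quotient_map_quotient_topology:
  assumes "f ` topspace T = Y"
  shows "quotient_map T (quotient_topology T f Y) f"
  using assms by (simp add: quotient_map_def openin_quotient_topology topspace_quotient_topology)

definition borel_of :: "'a topology \<Rightarrow> 'a measure" where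
  "borel_of T = sigma (topspace T) {U. openin T U}"

definition borel_prob_measure :: "'a topology \<Rightarrow> 'a measure \<Rightarrow> bool" where
  "borel_prob_measure T \<nu> \<longleftrightarrow> prob_space \<nu> \<and> sets \<nu> = sets (borel_of T)"

definition measure_support :: "'a topology \<Rightarrow> 'a measure \<Rightarrow> 'a set" where
  "measure_support T \<mu> =
     {x \<in> topspace T. \<forall>U. openin T U \<and> x \<in> U \<longrightarrow> emeasure \<mu> U > 0}"

text \<open>\<open>\<nu>\<close> is a \<open>\<mu>\<close>-stationary Borel probability measure on \<open>T\<close>, where \<open>act\<close> is the action on \<open>T\<close>
  of the group carrying \<open>\<mu>\<close>: \<open>\<integral> g\<^sub>* \<nu> d\<mu>(g) = \<nu>\<close>, evaluated on every Borel set.\<close>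

definition stationary ::
  "'g measure \<Rightarrow> ('g \<Rightarrow> 'a \<Rightarrow> 'a) \<Rightarrow> 'a topology \<Rightarrow> 'a measure \<Rightarrow> bool" where
  "stationary \<mu> act T \<nu> \<longleftrightarrow>
     borel_prob_measure T \<nu> \<and>
     (\<forall>A \<in> sets (borel_of T).
        (\<integral>\<^sup>+ g. emeasure (distr \<nu> (borel_of T) (act g)) A \<partial>\<mu>) = emeasure \<nu> A)"

text \<open>A disintegration of \<open>\<nu>\<close> over \<open>\<pi>\<close> with respect to \<open>\<nu>' = \<pi>\<^sub>* \<nu>\<close>: a measurable family of
  probability measures \<open>\<kappa> p\<close>, concentrated on the fibres \<open>\<pi>\<^sup>-\<^sup>1(p)\<close> for almost every \<open>p\<close>, with
  \<open>\<nu> = \<integral> \<kappa> p d\<nu>'(p)\<close>.\<close>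

definition disintegration ::
  "'a topology \<Rightarrow> ('a \<Rightarrow> 'b) \<Rightarrow> 'a measure \<Rightarrow> 'b measure \<Rightarrow> ('b \<Rightarrow> 'a measure) \<Rightarrow> bool" where
  "disintegration T \<pi> \<nu> \<nu>' \<kappa> \<longleftrightarrow>
     \<kappa> \<in> measurable \<nu>' (prob_algebra (borel_of T)) \<and>
     (AE p in \<nu>'. AE x in \<kappa> p. \<pi> x = p) \<and>
     (\<forall>A \<in> sets (borel_of T). emeasure \<nu> A = (\<integral>\<^sup>+ p. emeasure (\<kappa> p) A \<partial>\<nu>'))"

text \<open>Disintegrations are unique up to null sets on the spaces considered below, so it does not
  matter which of them is tested for being a family of point masses.\<close>

definition one_extension ::
  "'a topology \<Rightarrow> 'b topology \<Rightarrow> ('a \<Rightarrow> 'b) \<Rightarrow> 'a measure \<Rightarrow> 'b measure \<Rightarrow> bool" where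
  "one_extension T T' \<pi> \<nu> \<nu>' \<longleftrightarrow>
     borel_prob_measure T \<nu> \<and> borel_prob_measure T' \<nu>' \<and>
     distr \<nu> (borel_of T') \<pi> = \<nu>' \<and>
     (\<exists>\<kappa>. disintegration T \<pi> \<nu> \<nu>' \<kappa> \<and>
        (AE p in \<nu>'. \<exists>x \<in> topspace T. \<kappa> p = return (borel_of T) x))"

section \<open>The group \<open>SL\<^sub>3(\<real>)\<close> and the space of planes\<close>

definition SL3 :: "(real^3^3) monoid" where
  "SL3 = \<lparr>carrier = {g. det g = 1}, mult = (**), one = mat 1\<rparr>"

definition SL3_top :: "(real^3^3) topology" where
  "SL3_top = top_of_set (carrier SL3)"

definition e1 :: "real^3" where "e1 = axis 1 1"
definition e2 :: "real^3" where "e2 = axis 2 1"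

definition Gr2 :: "(real^3) set set" where
  "Gr2 = {p. subspace p \<and> dim p = 2}"

definition Gr2_act :: "real^3^3 \<Rightarrow> (real^3) set \<Rightarrow> (real^3) set" where
  "Gr2_act g p = (*v) g ` p"

text \<open>Both the Grassmannian and the space of lattices below carry their topology as homogeneous
  spaces: the quotient topology of \<open>SL\<^sub>3(\<real>)\<close> under the orbit map of a base point.\<close>

definition Gr2_top :: "(real^3) set topology" where
  "Gr2_top = quotient_topology SL3_top (\<lambda>g. Gr2_act g (span {e1, e2})) Gr2"

section \<open>Rank-2 discrete subgroups of \<open>\<real>\<^sup>3\<close> up to scaling\<close>

definition int_span2 :: "real^3 \<Rightarrow> real^3 \<Rightarrow> (real^3) set" where
  "int_span2 a b = {of_int m *\<^sub>R a + of_int n *\<^sub>R b | m n :: int. True}"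

text \<open>Rank 2 is meant in the sense of abelian groups: free on two generators.\<close>

definition lattices2 :: "(real^3) set set" where
  "lattices2 = {\<Lambda>. topological_space_class.discrete \<Lambda> \<and>
     (\<exists>a b. \<Lambda> = int_span2 a b \<and>
        (\<forall>m n :: int. of_int m *\<^sub>R a + of_int n *\<^sub>R b = 0 \<longrightarrow> m = 0 \<and> n = 0))}"

definition homothety :: "((real^3) set \<times> (real^3) set) set" where
  "homothety = {(\<Lambda>, \<Lambda>'). \<Lambda> \<in> lattices2 \<and> \<Lambda>' \<in> lattices2 \<and>
     (\<exists>c. c \<noteq> 0 \<and> \<Lambda>' = (\<lambda>v. c *\<^sub>R v) ` \<Lambda>)}"

definition X_space :: "(real^3) set set set" where
  "X_space = lattices2 // homothety"

definition X_act :: "real^3^3 \<Rightarrow> (real^3) set set \<Rightarrow> (real^3) set set" where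
  "X_act g x = (\<lambda>\<Lambda>. (*v) g ` \<Lambda>) ` x"

definition X_top :: "(real^3) set set topology" where
  "X_top = quotient_topology SL3_top (\<lambda>g. X_act g (homothety `` {int_span2 e1 e2})) X_space"

definition X_proj :: "(real^3) set set \<Rightarrow> (real^3) set" where
  "X_proj x = the_elem (span ` x)"

section \<open>Isotropic planes and the group \<open>\<Gamma>\<^sub>0\<close>\<close>

definition Q_form :: "real^3 \<Rightarrow> real" where
  "Q_form v = 2 * v$1 * v$3 - (v$2)\<^sup>2"

definition Q_polar :: "real^3 \<Rightarrow> real^3 \<Rightarrow> real" where
  "Q_polar v w = (Q_form (v + w) - Q_form v - Q_form w) / 2"

definition isotropic_planes :: "(real^3) set set" where
  "isotropic_planes = {p \<in> Gr2. \<exists>v\<in>p. v \<noteq> 0 \<and> (\<forall>w\<in>p. Q_polar v w = 0)}"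

definition u_plus :: "real^3^3" where
  "u_plus = vector [vector [1, 2, 2], vector [0, 1, 2], vector [0, 0, 1]]"

definition u_minus :: "real^3^3" where
  "u_minus = vector [vector [1, 0, 0], vector [2, 1, 0], vector [2, 2, 1]]"

definition Gamma0 :: "(real^3^3) set" where
  "Gamma0 = generate SL3 {u_plus, u_minus}"

definition furstenberg_measure :: "(real^3^3) measure \<Rightarrow> (real^3) set measure \<Rightarrow> bool" where
  "furstenberg_measure \<mu> \<nu> \<longleftrightarrow>
     stationary \<mu> Gr2_act Gr2_top \<nu> \<and>
     (\<forall>\<nu>'. stationary \<mu> Gr2_act Gr2_top \<nu>' \<longrightarrow> \<nu>' = \<nu>)"

definition equivariant_section :: "((real^3) set \<Rightarrow> (real^3) set set) \<Rightarrow> bool" where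
  "equivariant_section \<zeta> \<longleftrightarrow>
     continuous_map (subtopology Gr2_top isotropic_planes) X_top \<zeta> \<and>
     (\<forall>g\<in>Gamma0. \<forall>p\<in>isotropic_planes. \<zeta> (Gr2_act g p) = X_act g (\<zeta> p)) \<and>
     (\<forall>p\<in>isotropic_planes. X_proj (\<zeta> p) = p)"

text \<open>\<open>\<zeta>\<^sub>* \<nu>\<close> for a map \<open>\<zeta>\<close> defined on the isotropic planes only and a measure \<open>\<nu>\<close> on the whole
  Grassmannian. It is a probability measure only if \<open>\<nu>\<close> gives the isotropic planes full mass.\<close>

definition push_section ::
  "((real^3) set \<Rightarrow> (real^3) set set) \<Rightarrow> (real^3) set measure \<Rightarrow> (real^3) set set measure" where
  "push_section \<zeta> \<nu> = distr (restrict_space \<nu> isotropic_planes) (borel_of X_top) \<zeta>"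

end

theory Submission
  imports Defs
begin

text \<open>A vector of \<open>\<real>\<^sup>3\<close> is regarded as a binary quadratic form in such a way that \<open>Q\<close> becomes the negative
  of the discriminant. Up to scalars the isotropic vectors are then the squares \<open>w\<^sup>2\<close> of linear forms \<open>w\<close>, and
  the plane \<open>Q\<close>-orthogonal to \<open>w\<^sup>2\<close>, which is the isotropic plane with radical spanned by \<open>w\<^sup>2\<close>, consists of the
  products \<open>w \<cdot> x\<close>. Multiplication by \<open>w\<close> thus identifies the standard plane \<open>\<real>\<^sup>2\<close> of linear forms
  with the isotropic plane, and it carries \<open>\<int>\<^sup>2\<close> to a lattice \<open>w \<cdot> \<int>\<^sup>2\<close> in this plane. The plane determines
  \<open>w\<close> up to a scalar, so the homothety class of the lattice depends on the plane alone: this is the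
  section. Both generators of \<open>\<Gamma>\<^sub>0\<close> come from substitutions \<open>A\<close> of linear forms with \<open>A \<int>\<^sup>2 = \<int>\<^sup>2\<close>, that is,
  \<open>g (w \<cdot> x) = A w \<cdot> A x\<close>, so \<open>g (w \<cdot> \<int>\<^sup>2) = A w \<cdot> \<int>\<^sup>2\<close>, and the section is equivariant
  (\<open>Gamma0_equivariant\<close>). It is continuous because the lattice of \<open>w = (cos \<theta>, sin \<theta>)\<close> is the image of the
  standard lattice under a matrix that depends continuously on \<open>\<theta>\<close>, while the angle parametrises the
  isotropic planes by a quotient map, the Grassmannian being Hausdorff (\<open>continuous_map_iso_section\<close>).

  If the Furstenberg measure gives full mass to the isotropic planes, its image under an equivariant
  measurable section is stationary and has point masses as conditional measures
  (\<open>stationary_push_section\<close>, \<open>one_extension_push_section\<close>). That it does give them full mass is the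
  analytic part of the proof. Since the Furstenberg measure is the only stationary measure, it
  suffices to construct some stationary measure on the isotropic planes, and since these are the
  continuous image of a compact interval, one is found among the weak limits of the time averages of the random
  walk (\<open>exists_stationary_measure\<close>). The group generated by the support of \<open>\<mu>\<close> is the countable group \<open>\<Gamma>\<^sub>0\<close>,
  so \<open>\<mu>\<close> is discrete and the walk can be described by probability mass functions; the weak limit comes from
  Helly selection on the real line, and it is shown to be stationary by testing against
  continuous functions, which determine a measure on the isotropic planes
  (\<open>borel_prob_measure_eqI_continuous\<close>).\<close>

section \<open>The group \<open>SL\<^sub>3(\<real>)\<close> and quotient topologies\<close>

lemma carrier_SL3 [simp]: "g \<in> carrier SL3 \<longleftrightarrow> det g = 1"
  and mult_SL3 [simp]: "g \<otimes>\<^bsub>SL3\<^esub> h = g ** h"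
  and one_SL3 [simp]: "\<one>\<^bsub>SL3\<^esub> = mat 1"
  by (auto simp: SL3_def)

lemma SL3_inverse:
  assumes "det (g :: real^3^3) = 1"
  obtains h where "det h = 1" "g ** h = mat 1" "h ** g = mat 1"
proof -
  from assms have "invertible g" by (simp add: invertible_det_nz)
  then obtain h where h: "g ** h = mat 1" "h ** g = mat 1" by (auto simp: invertible_def)
  have "det h = 1" by (metis assms h(1) det_mul det_I mult_1)
  with h that show ?thesis by blast
qed

lemma group_SL3: "group SL3"
proof (rule groupI)
  fix g assume "g \<in> carrier SL3"
  then obtain h where "det h = 1" "h ** g = mat 1" by (auto elim: SL3_inverse)
  then show "\<exists>h\<in>carrier SL3. h \<otimes>\<^bsub>SL3\<^esub> g = \<one>\<^bsub>SL3\<^esub>"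
    by (intro bexI[of _ h]) auto
qed (auto simp: det_mul matrix_mul_assoc)

interpretation SL3: group SL3 by (rule group_SL3)

lemma topspace_SL3_top [simp]: "topspace SL3_top = carrier SL3"
  by (simp add: SL3_top_def)

lemma continuous_on_matrix_matrix_mult:
  fixes f g :: "'a::topological_space \<Rightarrow> real^3^3"
  assumes "continuous_on S f" "continuous_on S g"
  shows "continuous_on S (\<lambda>x. f x ** g x)"
  unfolding matrix_matrix_mult_def
  by (intro continuous_on_vec_lambda continuous_on_sum continuous_on_mult
      continuous_on_component assms)

lemma continuous_map_SL3_left_mult:
  assumes "det h = 1"
  shows "continuous_map SL3_top SL3_top (\<lambda>g. h ** g)"
proof -
  have "continuous_on (carrier SL3) (\<lambda>g. h ** g)"
    by (intro continuous_on_matrix_matrix_mult continuous_on_const continuous_on_id)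
  then show ?thesis by (auto simp: SL3_top_def assms det_mul)
qed

text \<open>The map onto the quotient is allowed to miss points of \<open>Y\<close>. A missed point is isolated in the
  quotient topology, so continuity of \<open>h\<close> is automatic there.\<close>

lemma continuous_map_from_quotient_topology:
  assumes "f ` topspace T \<subseteq> Y"
    and "continuous_map T Z (\<lambda>x. h (f x))" and "h ` Y \<subseteq> topspace Z"
  shows "continuous_map (quotient_topology T f Y) Z h"
  unfolding continuous_map_def topspace_quotient_topology[OF assms(1)]
proof (intro conjI allI impI)
  show "h \<in> Y \<rightarrow> topspace Z" using assms(3) by auto
  fix U assume "openin Z U"
  then have "openin T {x \<in> topspace T. h (f x) \<in> U}"
    using assms(2) by (simp add: continuous_map_def)
  moreover have "{x \<in> topspace T. f x \<in> {y \<in> Y. h y \<in> U}} = {x \<in> topspace T. h (f x) \<in> U}"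
    using assms(1) by auto
  ultimately show "openin (quotient_topology T f Y) {y \<in> Y. h y \<in> U}"
    by (auto simp: openin_quotient_topology)
qed

lemma continuous_map_into_quotient_topology:
  assumes "f ` topspace T \<subseteq> Y"
  shows "continuous_map T (quotient_topology T f Y) f"
  unfolding continuous_map_def topspace_quotient_topology[OF assms]
  using assms by (auto simp: openin_quotient_topology)

section \<open>The Grassmannian as a Hausdorff space\<close>

lemma Gr2_act_mult: "Gr2_act (g ** h) p = Gr2_act g (Gr2_act h p)"
  by (auto simp: Gr2_act_def image_image matrix_vector_mul_assoc)

lemma inj_SL3:
  assumes "det (g :: real^3^3) = 1" shows "inj ((*v) g)"
  using assms by (simp add: inj_matrix_vector_mult invertible_det_nz)

lemma Gr2_act_in_Gr2:
  assumes "det g = 1" "p \<in> Gr2" shows "Gr2_act g p \<in> Gr2"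
proof -
  have "dim ((*v) g ` p) = dim p"
    using inj_SL3[OF assms(1)] by (intro dim_image_eq) (auto intro: inj_on_subset)
  then show ?thesis using assms
    by (auto simp: Gr2_def Gr2_act_def intro!: linear_subspace_image)
qed

lemma hyperplane_in_Gr2: "n \<noteq> 0 \<Longrightarrow> {x :: real^3. n \<bullet> x = 0} \<in> Gr2"
  by (simp add: Gr2_def subspace_hyperplane dim_hyperplane)

lemma Gr2_subset_eq:
  assumes "p \<in> Gr2" "q \<in> Gr2" "p \<subseteq> q" shows "p = q"
  using assms subspace_dim_equal[of p q] by (simp add: Gr2_def)

lemma Gr2_eq_hyperplane:
  assumes "p \<in> Gr2"
  obtains n :: "real^3" where "n \<noteq> 0" "p = {x. n \<bullet> x = 0}"
proof -
  have "dim p < DIM(real^3)" using assms by (simp add: Gr2_def)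
  then obtain n where n: "n \<noteq> 0" "span p \<subseteq> {x. n \<bullet> x = 0}"
    using lowdim_subset_hyperplane by blast
  have "p = {x. n \<bullet> x = 0}"
    using n assms span_superset[of p]
    by (intro Gr2_subset_eq hyperplane_in_Gr2) auto
  with n that show ?thesis by blast
qed

definition base_plane :: "(real^3) set" where "base_plane = span {e1, e2}"

lemma base_plane_eq: "base_plane = {x. axis 3 1 \<bullet> x = 0}"
proof -
  have "x \<in> base_plane" if "x$3 = 0" for x :: "real^3"
  proof -
    have "x = x$1 *\<^sub>R e1 + x$2 *\<^sub>R e2"
      using that by (simp add: vec_eq_iff forall_3 e1_def e2_def axis_def)
    then show ?thesis unfolding base_plane_def
      by (metis insertCI span_add span_base span_mul)
  qed
  moreover have "base_plane \<subseteq> {x. axis 3 1 \<bullet> x = 0}"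
    unfolding base_plane_def
    by (intro span_minimal subspace_hyperplane) (auto simp: e1_def e2_def inner_axis_axis)
  ultimately show ?thesis by (auto simp: inner_axis')
qed

lemma base_plane_in_Gr2: "base_plane \<in> Gr2"
  unfolding base_plane_eq by (rule hyperplane_in_Gr2) simp

lemma Gr2_top_eq: "Gr2_top = quotient_topology SL3_top (\<lambda>g. Gr2_act g base_plane) Gr2"
  by (simp add: Gr2_top_def base_plane_def)

lemma Gr2_orbit: "(\<lambda>g. Gr2_act g base_plane) ` topspace SL3_top \<subseteq> Gr2"
  by (auto intro: Gr2_act_in_Gr2 base_plane_in_Gr2)

lemma topspace_Gr2_top [simp]: "topspace Gr2_top = Gr2"
  unfolding Gr2_top_eq by (rule topspace_quotient_topology[OF Gr2_orbit])

lemma continuous_map_Gr2_orbit: "continuous_map SL3_top Gr2_top (\<lambda>g. Gr2_act g base_plane)"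
  unfolding Gr2_top_eq by (rule continuous_map_into_quotient_topology[OF Gr2_orbit])

lemma continuous_map_Gr2_act:
  assumes "det g = 1" shows "continuous_map Gr2_top Gr2_top (Gr2_act g)"
proof -
  have "continuous_map SL3_top Gr2_top ((\<lambda>h. Gr2_act h base_plane) \<circ> (\<lambda>h. g ** h))"
    by (rule continuous_map_compose[OF continuous_map_SL3_left_mult[OF assms] continuous_map_Gr2_orbit])
  then have "continuous_map SL3_top Gr2_top (\<lambda>h. Gr2_act g (Gr2_act h base_plane))"
    by (simp add: o_def Gr2_act_mult)
  then have "continuous_map (quotient_topology SL3_top (\<lambda>g. Gr2_act g base_plane) Gr2)
      Gr2_top (Gr2_act g)"
    by (intro continuous_map_from_quotient_topology[OF Gr2_orbit]) (auto intro: Gr2_act_in_Gr2 assms)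
  then show ?thesis by (simp add: Gr2_top_eq)
qed

text \<open>The matrix of the orthogonal projection onto \<open>p\<close>. It embeds the Grassmannian continuously into a
  Euclidean space; this embedding serves both to see that the quotient topology is Hausdorff and
  to supply enough continuous functions to tell Borel measures apart.\<close>

definition plane_projection :: "(real^3) set \<Rightarrow> real^3^3" where
  "plane_projection p = (\<chi> i j. closest_point p (axis j 1) $ i)"

lemma closest_point_hyperplane:
  fixes n :: "real^3"
  assumes "n \<noteq> 0"
  shows "closest_point {x. n \<bullet> x = 0} v = v - (n \<bullet> v / (n \<bullet> n)) *\<^sub>R n"
proof (rule closest_point_unique[symmetric])
  let ?x = "v - (n \<bullet> v / (n \<bullet> n)) *\<^sub>R n"
  show "convex {x. n \<bullet> x = 0}" by (rule convex_hyperplane)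
  show "closed {x. n \<bullet> x = 0}" by (rule closed_hyperplane)
  show "?x \<in> {x. n \<bullet> x = 0}" using assms by (simp add: inner_diff_right)
  show "\<forall>z\<in>{x. n \<bullet> x = 0}. dist v ?x \<le> dist v z"
  proof
    fix z assume "z \<in> {x. n \<bullet> x = 0}"
    then have "n \<bullet> v = n \<bullet> (v - z)" by (simp add: inner_diff_right)
    then have "\<bar>n \<bullet> v\<bar> \<le> norm n * norm (v - z)" by (metis Cauchy_Schwarz_ineq2)
    moreover have "dist v ?x = \<bar>n \<bullet> v\<bar> / norm n"
      using assms by (simp add: dist_norm dot_square_norm power2_eq_square)
    ultimately show "dist v ?x \<le> dist v z"
      using assms by (simp only: dist_norm) (simp add: pos_divide_le_eq mult.commute)
  qed
qed

lemma plane_projection_hyperplane: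
  fixes n :: "real^3"
  assumes "n \<noteq> 0"
  shows "plane_projection {x. n \<bullet> x = 0} = (\<chi> i j. (if i = j then 1 else 0) - n$j * n$i / (n \<bullet> n))"
  by (simp add: plane_projection_def vec_eq_iff closest_point_hyperplane[OF assms] inner_axis) (simp add: axis_def)

lemma plane_projection_mult:
  assumes "p \<in> Gr2" shows "plane_projection p *v x = closest_point p x"
proof -
  from assms obtain n where n: "n \<noteq> 0" "p = {x. n \<bullet> x = 0}" by (rule Gr2_eq_hyperplane)
  have "linear (closest_point p)"
    unfolding n(2)
    by (rule linearI; simp only: closest_point_hyperplane[OF n(1)])
      (simp_all add: inner_add_right scaleR_add_left scaleR_diff_right add_divide_distrib)
  then have "closest_point p x = matrix (closest_point p) *v x"
    by (simp add: matrix_works linear_matrix_vector_mul_eq)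
  also have "matrix (closest_point p) = plane_projection p"
    by (simp add: matrix_def plane_projection_def)
  finally show ?thesis by simp
qed

text \<open>A plane is the fixed space of its projection.\<close>

lemma inj_on_plane_projection: "inj_on plane_projection Gr2"
proof -
  have "p = {x. plane_projection p *v x = x}" if "p \<in> Gr2" for p
  proof -
    have "closed p" "p \<noteq> {}" using that
      by (auto simp: Gr2_def closed_subspace subspace_def)
    then have "x \<in> p \<longleftrightarrow> closest_point p x = x" for x
      by (metis closest_point_in_set closest_point_self)
    then show ?thesis by (auto simp: plane_projection_mult[OF that])
  qed
  note eq = this
  show ?thesis
  proof (rule inj_onI)
    fix p q assume "p \<in> Gr2" "q \<in> Gr2" "plane_projection p = plane_projection q"
    then show "p = q" using eq[of p] eq[of q] by simp
  qed
qed

text \<open>A normal vector of the plane \<open>g \<cdot> span {e1, e2}\<close> that is polynomial in \<open>g\<close>: the plane is spanned by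
  the first two columns of \<open>g\<close>.\<close>

definition orbit_normal :: "real^3^3 \<Rightarrow> real^3" where
  "orbit_normal g = cross3 (column 1 g) (column 2 g)"

lemma orbit_normal:
  assumes "det g = 1"
  shows "orbit_normal g \<noteq> 0" "Gr2_act g base_plane = {x. orbit_normal g \<bullet> x = 0}"
proof -
  \<comment> \<open>The triple product of the columns is the determinant, so the normal cannot vanish.\<close>
  have "orbit_normal g \<bullet> column 3 g = det g"
    by (simp add: orbit_normal_def cross3_def det_3 inner_vec_def sum_3 column_def vector_def algebra_simps)
  with assms show nz: "orbit_normal g \<noteq> 0" by auto
  have "Gr2_act g base_plane \<subseteq> {x. orbit_normal g \<bullet> x = 0}"
  proof -
    have "orbit_normal g \<bullet> (g *v x) = 0" if "x$3 = 0" for x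
      using that
      by (simp add: orbit_normal_def cross3_def inner_vec_def sum_3 column_def
          matrix_vector_mult_def vector_def algebra_simps)
    then show ?thesis by (auto simp: Gr2_act_def base_plane_eq inner_axis')
  qed
  then show "Gr2_act g base_plane = {x. orbit_normal g \<bullet> x = 0}"
    by (intro Gr2_subset_eq Gr2_act_in_Gr2 base_plane_in_Gr2 hyperplane_in_Gr2 nz assms)
qed

text \<open>Continuity on a quotient is tested on the orbit map, where the projection is a rational function
  of the normal vector with nonvanishing denominator.\<close>

lemma continuous_map_plane_projection: "continuous_map Gr2_top euclidean plane_projection"
  unfolding Gr2_top_eq
proof (rule continuous_map_from_quotient_topology[OF Gr2_orbit])
  have cont: "continuous_on (carrier SL3) orbit_normal"
    unfolding orbit_normal_def column_def
    by (intro continuous_on_cross continuous_on_vec_lambda continuous_on_component continuous_on_id)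
  have "continuous_on (carrier SL3) (\<lambda>g. plane_projection (Gr2_act g base_plane))
    \<longleftrightarrow> continuous_on (carrier SL3) (\<lambda>g. \<chi> i j. (if i = j then 1 else 0)
      - orbit_normal g$j * orbit_normal g$i / (orbit_normal g \<bullet> orbit_normal g))"
    by (intro continuous_on_cong refl) (simp only: carrier_SL3 orbit_normal(2) plane_projection_hyperplane[OF orbit_normal(1)])
  also have \<dots>
    by (intro continuous_on_vec_lambda continuous_on_diff continuous_on_const continuous_on_divide
      continuous_on_mult continuous_on_inner continuous_on_component cont) (simp add: orbit_normal(1))
  finally show "continuous_map SL3_top euclidean (\<lambda>g. plane_projection (Gr2_act g base_plane))"
    by (simp add: SL3_top_def)
qed simp

lemma Hausdorff_Gr2_top: "Hausdorff_space Gr2_top"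
  by (rule Hausdorff_space_injective_preimage[OF _ continuous_map_plane_projection])
    (auto simp: inj_on_plane_projection)

section \<open>Lattices of rank two up to scaling\<close>

definition real_independent :: "real^3 \<Rightarrow> real^3 \<Rightarrow> bool" where
  "real_independent a b \<longleftrightarrow> (\<forall>r s :: real. r *\<^sub>R a + s *\<^sub>R b = 0 \<longrightarrow> r = 0 \<and> s = 0)"

definition lin_comb :: "real^3 \<Rightarrow> real^3 \<Rightarrow> real \<times> real \<Rightarrow> real^3" where
  "lin_comb a b x = fst x *\<^sub>R a + snd x *\<^sub>R b"

lemma linear_lin_comb: "linear (lin_comb a b)"
  by (auto intro!: linearI simp: lin_comb_def algebra_simps)

lemma inj_lin_comb: "real_independent a b \<Longrightarrow> inj (lin_comb a b)"
  by (subst linear_injective_0[OF linear_lin_comb]) (auto simp: lin_comb_def real_independent_def zero_prod_def)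

lemma range_lin_comb: "range (lin_comb a b) = span {a, b}"
proof (intro subset_antisym span_minimal)
  show "range (lin_comb a b) \<subseteq> span {a, b}"
    by (auto simp: lin_comb_def span_add span_mul span_base)
  have "lin_comb a b (1, 0) = a" "lin_comb a b (0, 1) = b" by (auto simp: lin_comb_def)
  then show "{a, b} \<subseteq> range (lin_comb a b)" by (metis insert_subset rangeI empty_subsetI)
  show "subspace (range (lin_comb a b))"
    by (intro linear_subspace_image linear_lin_comb subspace_UNIV)
qed

lemma span_in_Gr2:
  assumes "real_independent a b" shows "span {a, b} \<in> Gr2"
proof -
  have "dim (range (lin_comb a b)) = dim (UNIV :: (real \<times> real) set)"
    by (intro dim_image_eq linear_lin_comb inj_on_subset[OF inj_lin_comb[OF assms]]) auto
  then show ?thesis by (simp add: Gr2_def range_lin_comb)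
qed

text \<open>An injective linear map of finite-dimensional spaces expands norms by a definite factor, and
  distinct points of \<open>\<int>\<^sup>2\<close> have distance at least one.\<close>

lemma discrete_int_span2:
  assumes "real_independent a b" shows "topological_space_class.discrete (int_span2 a b)"
proof -
  obtain B where B: "B > 0" "\<And>x. B * norm x \<le> norm (lin_comb a b x)"
    using linear_inj_bounded_below_pos[OF linear_lin_comb inj_lin_comb[OF assms]] by blast
  have "y = x" if "x \<in> int_span2 a b" "y \<in> int_span2 a b" "dist x y < B" for x y
  proof (rule ccontr)
    assume "y \<noteq> x"
    from that obtain m n m' n' :: int where
      xy: "x = of_int m *\<^sub>R a + of_int n *\<^sub>R b" "y = of_int m' *\<^sub>R a + of_int n' *\<^sub>R b"
      by (auto simp: int_span2_def)
    let ?z = "(of_int (m - m'), of_int (n - n')) :: real \<times> real"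
    have "x - y = lin_comb a b ?z"
      by (simp add: xy lin_comb_def algebra_simps)
    then have "B * norm ?z < B * 1" using B(2)[of ?z] that(3) by (simp add: dist_norm)
    then have "norm ?z < 1" using B(1) by simp
    moreover have "norm (of_int (m - m') :: real) \<le> norm ?z" by (rule norm_fst_le)
    moreover have "norm (of_int (n - n') :: real) \<le> norm ?z" by (rule norm_snd_le)
    ultimately have "\<bar>of_int (m - m') :: real\<bar> < 1" "\<bar>of_int (n - n') :: real\<bar> < 1"
      by (simp_all only: real_norm_def)
    then have "m = m'" "n = n'" by linarith+
    with \<open>y \<noteq> x\<close> show False by (simp add: xy)
  qed
  with B(1) show ?thesis
    by (auto simp: discrete_def isolated_in_dist_Ex_iff)
qed

text \<open>If \<open>a\<close> and \<open>b\<close> were linearly dependent but independent over \<open>\<int>\<close>, then \<open>b = \<theta> a\<close>, and rational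
  approximations \<open>p / q\<close> of \<open>\<theta>\<close> would give nonzero elements \<open>q b - p a\<close> of the group that are
  arbitrarily small.\<close>

lemma real_independent_if_discrete:
  assumes discrete: "topological_space_class.discrete (int_span2 a b)"
    and int_indep: "\<And>m n :: int. of_int m *\<^sub>R a + of_int n *\<^sub>R b = 0 \<Longrightarrow> m = 0 \<and> n = 0"
  shows "real_independent a b"
proof (rule ccontr)
  assume "\<not> real_independent a b"
  then obtain r s where rs: "r *\<^sub>R a + s *\<^sub>R b = 0" "r \<noteq> 0 \<or> s \<noteq> 0"
    by (auto simp: real_independent_def)
  have "a \<noteq> 0" using int_indep[of 1 0] by auto
  with rs have "s \<noteq> 0" by auto
  define \<theta> where "\<theta> = - r / s"
  have b: "b = \<theta> *\<^sub>R a"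
  proof -
    have "s *\<^sub>R b = s *\<^sub>R (\<theta> *\<^sub>R a)"
      using rs(1) \<open>s \<noteq> 0\<close> by (simp add: \<theta>_def add_eq_0_iff)
    then show ?thesis using \<open>s \<noteq> 0\<close> by (simp only: scaleR_cancel_left) simp
  qed
  have "0 = of_int 0 *\<^sub>R a + of_int 0 *\<^sub>R b" by simp
  then have "0 \<in> int_span2 a b" by (auto simp: int_span2_def simp del: of_int_0)
  with discrete obtain e where e: "e > 0" "\<And>y. y \<in> int_span2 a b \<Longrightarrow> norm y < e \<Longrightarrow> y = 0"
    by (auto simp: discrete_def isolated_in_dist_Ex_iff)
  obtain N :: nat where N: "N > 0" "norm a / e < real N"
    using reals_Archimedean2[of "norm a / e"] \<open>a \<noteq> 0\<close> e(1)
    by (metis divide_pos_pos gr0I norm_eq_zero norm_ge_zero order_le_less of_nat_0 less_asym)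
  obtain q p where qp: "0 < q" "\<bar>of_int q * \<theta> - of_int p\<bar> < 1 / real N"
    using Dirichlet_approx[OF N(1), of \<theta>] by metis
  let ?v = "of_int (- p) *\<^sub>R a + of_int q *\<^sub>R b"
  have "?v = (of_int q * \<theta> - of_int p) *\<^sub>R a" by (simp add: b algebra_simps)
  then have "norm ?v = \<bar>of_int q * \<theta> - of_int p\<bar> * norm a" by simp
  also have "\<dots> < 1 / real N * norm a" using qp(2) \<open>a \<noteq> 0\<close> by (intro mult_strict_right_mono) auto
  also have "\<dots> < e" using N e(1) by (simp add: field_simps)
  finally have "?v = 0" by (intro e(2)) (auto simp: int_span2_def simp del: of_int_minus)
  then show False using int_indep[of "- p" q] qp(1) by simp
qed

text \<open>A discrete subgroup of rank two is therefore the same thing as the group generated by two linearly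
  independent vectors. In particular its span is a plane, which makes \<^const>\<open>X_proj\<close> well defined
  as a map to the Grassmannian.\<close>

lemma lattices2_iff:
  "\<Lambda> \<in> lattices2 \<longleftrightarrow> (\<exists>a b. \<Lambda> = int_span2 a b \<and> real_independent a b)"
proof
  assume "\<Lambda> \<in> lattices2"
  then show "\<exists>a b. \<Lambda> = int_span2 a b \<and> real_independent a b"
    unfolding lattices2_def by (blast intro: real_independent_if_discrete)
next
  assume "\<exists>a b. \<Lambda> = int_span2 a b \<and> real_independent a b"
  then obtain a b where ab: "\<Lambda> = int_span2 a b" "real_independent a b" by blast
  then have "\<forall>m n :: int. of_int m *\<^sub>R a + of_int n *\<^sub>R b = 0 \<longrightarrow> m = 0 \<and> n = 0"
    unfolding real_independent_def by (metis of_int_eq_0_iff)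
  with ab show "\<Lambda> \<in> lattices2"
    using discrete_int_span2[OF ab(2)] by (auto simp: lattices2_def)
qed

lemma linear_image_int_span2:
  assumes "linear f" shows "f ` int_span2 a b = int_span2 (f a) (f b)"
proof -
  have "f (of_int m *\<^sub>R a + of_int n *\<^sub>R b) = of_int m *\<^sub>R f a + of_int n *\<^sub>R f b" for m n
    by (simp add: linear_add[OF assms] linear_scale[OF assms])
  then show ?thesis unfolding int_span2_def by (auto simp: image_iff) metis+
qed

lemma linear_image_lattices2:
  assumes "linear f" "inj f" "\<Lambda> \<in> lattices2" shows "f ` \<Lambda> \<in> lattices2"
proof -
  from assms(3) obtain a b where ab: "\<Lambda> = int_span2 a b" "real_independent a b"
    by (auto simp: lattices2_iff)
  have "f x = 0 \<Longrightarrow> x = 0" for x using assms(1,2) by (metis linear_0 injD)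
  then have "real_independent (f a) (f b)"
    using ab(2) unfolding real_independent_def
    by (metis linear_add[OF assms(1)] linear_scale[OF assms(1)])
  with ab(1) show ?thesis by (auto simp: lattices2_iff linear_image_int_span2[OF assms(1)])
qed

lemma scale_lattices2:
  assumes "c \<noteq> 0" "\<Lambda> \<in> lattices2" shows "(\<lambda>v. c *\<^sub>R v) ` \<Lambda> \<in> lattices2"
  using assms by (intro linear_image_lattices2) (auto intro: injI)

lemma homothety_class:
  assumes "\<Lambda> \<in> lattices2"
  shows "homothety `` {\<Lambda>} = {(\<lambda>v. c *\<^sub>R v) ` \<Lambda> | c. c \<noteq> 0}"
  using assms by (auto simp: homothety_def intro: scale_lattices2)

lemma homothety_class_scale:
  assumes "\<Lambda> \<in> lattices2" "c \<noteq> 0"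
  shows "homothety `` {(\<lambda>v. c *\<^sub>R v) ` \<Lambda>} = homothety `` {\<Lambda>}"
proof -
  have "{(\<lambda>v. d *\<^sub>R v) ` (\<lambda>v. c *\<^sub>R v) ` \<Lambda> | d. d \<noteq> 0} = {(\<lambda>v. d *\<^sub>R v) ` \<Lambda> | d. d \<noteq> 0}"
    (is "?L = ?R")
  proof (intro subset_antisym subsetI)
    fix M assume "M \<in> ?L"
    then obtain d where "d \<noteq> 0" "M = (\<lambda>v. (d * c) *\<^sub>R v) ` \<Lambda>" by (auto simp: image_image)
    with assms show "M \<in> ?R" by (metis (mono_tags, lifting) mem_Collect_eq mult_eq_0_iff)
  next
    fix M assume "M \<in> ?R"
    then obtain d where "d \<noteq> 0" "M = (\<lambda>v. d *\<^sub>R v) ` \<Lambda>" by auto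
    with assms have "M = (\<lambda>v. (d / c) *\<^sub>R v) ` (\<lambda>v. c *\<^sub>R v) ` \<Lambda>" "d / c \<noteq> 0"
      by (auto simp: image_image)
    then show "M \<in> ?L" by blast
  qed
  then show ?thesis using assms by (simp add: homothety_class scale_lattices2)
qed

lemma X_space_eq: "X_space = (\<lambda>\<Lambda>. homothety `` {\<Lambda>}) ` lattices2"
  by (auto simp: X_space_def quotient_def)

text \<open>Linear maps commute with homotheties, so the action on classes can be computed on representatives.\<close>

lemma X_act_class:
  assumes "det g = 1" "\<Lambda> \<in> lattices2"
  shows "(*v) g ` \<Lambda> \<in> lattices2" "X_act g (homothety `` {\<Lambda>}) = homothety `` {(*v) g ` \<Lambda>}"
proof -
  show lat: "(*v) g ` \<Lambda> \<in> lattices2"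
    using assms by (intro linear_image_lattices2) (auto simp: inj_SL3)
  have "(*v) g ` (\<lambda>v. c *\<^sub>R v) ` \<Lambda> = (\<lambda>v. c *\<^sub>R v) ` (*v) g ` \<Lambda>" for c
    by (simp add: image_image matrix_vector_mult_scaleR)
  then show "X_act g (homothety `` {\<Lambda>}) = homothety `` {(*v) g ` \<Lambda>}"
    by (auto simp: X_act_def homothety_class[OF assms(2)] homothety_class[OF lat] image_iff) metis+
qed

lemma X_act_in_X_space:
  assumes "det g = 1" "x \<in> X_space" shows "X_act g x \<in> X_space"
  using assms by (auto simp: X_space_eq X_act_class)

lemma X_act_mult: "X_act (g ** h) x = X_act g (X_act h x)"
  by (simp add: X_act_def image_image matrix_vector_mul_assoc)

lemma X_proj_class:
  assumes "\<Lambda> \<in> lattices2" shows "X_proj (homothety `` {\<Lambda>}) = span \<Lambda>"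
proof -
  have "span ((\<lambda>v. c *\<^sub>R v) ` \<Lambda>) = span \<Lambda>" if "c \<noteq> 0" for c
  proof (intro subset_antisym span_minimal subspace_span)
    show "(\<lambda>v. c *\<^sub>R v) ` \<Lambda> \<subseteq> span \<Lambda>" by (auto intro: span_mul span_base)
    show "\<Lambda> \<subseteq> span ((\<lambda>v. c *\<^sub>R v) ` \<Lambda>)"
    proof
      fix v assume "v \<in> \<Lambda>"
      then have "(1 / c) *\<^sub>R (c *\<^sub>R v) \<in> span ((\<lambda>v. c *\<^sub>R v) ` \<Lambda>)"
        by (intro span_mul span_base) auto
      then show "v \<in> span ((\<lambda>v. c *\<^sub>R v) ` \<Lambda>)" using that by simp
    qed
  qed
  then have "span ` {(\<lambda>v. c *\<^sub>R v) ` \<Lambda> | c. c \<noteq> 0} = {span \<Lambda>}"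
    by (auto intro!: image_eqI[of _ _ "(\<lambda>v. 1 *\<^sub>R v) ` \<Lambda>"] exI[of _ "1 :: real"])
  then show ?thesis by (simp add: X_proj_def homothety_class[OF assms])
qed

lemma span_int_span2: "span (int_span2 a b) = span {a, b}"
proof (intro subset_antisym span_minimal subspace_span)
  show "int_span2 a b \<subseteq> span {a, b}"
    by (auto simp: int_span2_def span_add span_mul span_base)
  have "a = of_int 1 *\<^sub>R a + of_int 0 *\<^sub>R b" "b = of_int 0 *\<^sub>R a + of_int 1 *\<^sub>R b" by simp_all
  then have "a \<in> int_span2 a b" "b \<in> int_span2 a b"
    unfolding int_span2_def by blast+
  then show "{a, b} \<subseteq> span (int_span2 a b)" by (auto intro: span_base)
qed

lemma span_lattice_in_Gr2: "\<Lambda> \<in> lattices2 \<Longrightarrow> span \<Lambda> \<in> Gr2"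
  by (auto simp: lattices2_iff span_int_span2 span_in_Gr2)

definition base_lattice :: "(real^3) set set" where
  "base_lattice = homothety `` {int_span2 e1 e2}"

lemma int_span2_e1_e2: "int_span2 e1 e2 \<in> lattices2"
proof -
  have "real_independent e1 e2"
    by (auto simp: real_independent_def e1_def e2_def vec_eq_iff forall_3 axis_def)
  then show ?thesis by (auto simp: lattices2_iff)
qed

lemma base_lattice_in_X_space: "base_lattice \<in> X_space"
  by (auto simp: base_lattice_def X_space_eq int_span2_e1_e2)

lemma X_top_eq: "X_top = quotient_topology SL3_top (\<lambda>g. X_act g base_lattice) X_space"
  by (simp add: X_top_def base_lattice_def)

lemma X_orbit: "(\<lambda>g. X_act g base_lattice) ` topspace SL3_top \<subseteq> X_space"
  by (auto intro: X_act_in_X_space base_lattice_in_X_space)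

lemma topspace_X_top [simp]: "topspace X_top = X_space"
  unfolding X_top_eq by (rule topspace_quotient_topology[OF X_orbit])

lemma continuous_map_X_orbit: "continuous_map SL3_top X_top (\<lambda>g. X_act g base_lattice)"
  unfolding X_top_eq by (rule continuous_map_into_quotient_topology[OF X_orbit])

lemma continuous_map_X_act:
  assumes "det g = 1" shows "continuous_map X_top X_top (X_act g)"
proof -
  have "continuous_map SL3_top X_top ((\<lambda>h. X_act h base_lattice) \<circ> (\<lambda>h. g ** h))"
    by (rule continuous_map_compose[OF continuous_map_SL3_left_mult[OF assms] continuous_map_X_orbit])
  then have "continuous_map SL3_top X_top (\<lambda>h. X_act g (X_act h base_lattice))"
    by (simp add: o_def X_act_mult)
  then have "continuous_map (quotient_topology SL3_top (\<lambda>g. X_act g base_lattice) X_space)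
      X_top (X_act g)"
    by (intro continuous_map_from_quotient_topology[OF X_orbit]) (auto intro: X_act_in_X_space assms)
  then show ?thesis by (simp add: X_top_eq)
qed

text \<open>The projection intertwines the two orbit maps; this is what makes it continuous for the quotient
  topologies.\<close>

lemma X_proj_orbit:
  assumes "det g = 1" shows "X_proj (X_act g base_lattice) = Gr2_act g base_plane"
  using X_act_class[OF assms int_span2_e1_e2]
  by (simp add: base_lattice_def X_proj_class Gr2_act_def base_plane_def linear_span_image
      span_int_span2)

lemma continuous_map_X_proj: "continuous_map X_top Gr2_top X_proj"
  unfolding X_top_eq
proof (rule continuous_map_from_quotient_topology[OF X_orbit])
  show "continuous_map SL3_top Gr2_top (\<lambda>g. X_proj (X_act g base_lattice))"
    by (rule continuous_map_eq[OF continuous_map_Gr2_orbit]) (simp add: X_proj_orbit)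
  show "X_proj ` X_space \<subseteq> topspace Gr2_top"
    by (auto simp: X_space_eq X_proj_class span_lattice_in_Gr2)
qed

section \<open>Isotropic planes as products of linear forms\<close>

text \<open>The product of the linear forms \<open>w\<^sub>1 X + w\<^sub>2 Y\<close> and \<open>x\<^sub>1 X + x\<^sub>2 Y\<close>, where the quadratic form
  \<open>\<alpha> X\<^sup>2 + \<beta> X Y + \<gamma> Y\<^sup>2\<close> is recorded as the vector \<open>(\<alpha>, \<beta>, 2 \<gamma>)\<close>. In these coordinates
  \<^const>\<open>Q_form\<close> is \<open>4 \<alpha> \<gamma> - \<beta>\<^sup>2\<close>, the negative of the discriminant. The factor \<open>2\<close> turns the
  generators of \<^const>\<open>Gamma0\<close> into substitutions with integer coefficients.\<close>

definition sym_mult :: "real \<times> real \<Rightarrow> real \<times> real \<Rightarrow> real^3" where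
  "sym_mult w x = vector [fst w * fst x, fst w * snd x + snd w * fst x, 2 * snd w * snd x]"

lemma sym_mult_nth [simp]:
  "sym_mult w x $ 1 = fst w * fst x"
  "sym_mult w x $ 2 = fst w * snd x + snd w * fst x"
  "sym_mult w x $ 3 = 2 * snd w * snd x"
  by (simp_all add: sym_mult_def)

lemma sym_mult_scaleR_left: "sym_mult (c *\<^sub>R w) x = c *\<^sub>R sym_mult w x"
  by (simp add: vec_eq_iff forall_3 algebra_simps)

lemma sym_mult_eq_lin_comb: "sym_mult w = lin_comb (sym_mult w (1, 0)) (sym_mult w (0, 1))"
  by (rule ext) (simp add: lin_comb_def vec_eq_iff forall_3 algebra_simps)

lemma real_independent_sym_mult:
  assumes "w \<noteq> 0" shows "real_independent (sym_mult w (1, 0)) (sym_mult w (0, 1))"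
  using assms by (cases w) (auto simp: real_independent_def vec_eq_iff forall_3 zero_prod_def)

text \<open>The quadratic forms divisible by \<open>w\<close>. They make up the plane that is \<open>Q\<close>-orthogonal to the isotropic
  vector \<open>w\<^sup>2\<close>, and multiplication by \<open>w\<close> identifies it with \<open>\<real>\<^sup>2\<close>.\<close>

definition iso_plane :: "real \<times> real \<Rightarrow> (real^3) set" where
  "iso_plane w = range (sym_mult w)"

definition int_pairs :: "(real \<times> real) set" where
  "int_pairs = {(of_int m, of_int n) | m n :: int. True}"

text \<open>The lattice that \<open>\<int>\<^sup>2\<close> becomes under multiplication by \<open>w\<close>.\<close>

definition iso_lattice :: "real \<times> real \<Rightarrow> (real^3) set" where
  "iso_lattice w = sym_mult w ` int_pairs"

lemma iso_plane_eq_span: "iso_plane w = span {sym_mult w (1, 0), sym_mult w (0, 1)}"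
  unfolding iso_plane_def by (subst sym_mult_eq_lin_comb) (rule range_lin_comb)

lemma iso_lattice_eq_int_span2: "iso_lattice w = int_span2 (sym_mult w (1, 0)) (sym_mult w (0, 1))"
  unfolding iso_lattice_def
  by (subst sym_mult_eq_lin_comb) (force simp: int_span2_def int_pairs_def lin_comb_def)

lemma iso_plane_in_Gr2: "w \<noteq> 0 \<Longrightarrow> iso_plane w \<in> Gr2"
  by (simp add: iso_plane_eq_span span_in_Gr2 real_independent_sym_mult)

lemma iso_lattice_in_lattices2: "w \<noteq> 0 \<Longrightarrow> iso_lattice w \<in> lattices2"
  unfolding lattices2_iff iso_lattice_eq_int_span2 using real_independent_sym_mult by blast

lemma span_iso_lattice: "span (iso_lattice w) = iso_plane w"
  by (simp add: iso_lattice_eq_int_span2 iso_plane_eq_span span_int_span2)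

lemma iso_plane_scaleR:
  assumes "c \<noteq> 0" shows "iso_plane (c *\<^sub>R w) = iso_plane w"
proof -
  have "sym_mult (c *\<^sub>R w) x = sym_mult w (c *\<^sub>R x)" "sym_mult w x = sym_mult (c *\<^sub>R w) ((1 / c) *\<^sub>R x)" for x
    using assms by (simp_all add: vec_eq_iff forall_3 field_simps)
  then show ?thesis unfolding iso_plane_def by (metis (no_types, lifting) rangeI image_subsetI subset_antisym)
qed

lemma iso_lattice_scaleR:
  "iso_lattice (c *\<^sub>R w) = (\<lambda>v. c *\<^sub>R v) ` iso_lattice w"
  by (simp add: iso_lattice_def image_image sym_mult_scaleR_left)

text \<open>The Euclidean normal of the plane: its inner product with a vector is twice the value
  of the corresponding quadratic form at the zero \<open>(- w\<^sub>2, w\<^sub>1)\<close> of the linear form \<open>w\<close>.\<close>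

definition iso_normal :: "real \<times> real \<Rightarrow> real^3" where
  "iso_normal w = vector [2 * (snd w)\<^sup>2, - 2 * fst w * snd w, (fst w)\<^sup>2]"

lemma iso_normal_nonzero: "w \<noteq> 0 \<Longrightarrow> iso_normal w \<noteq> 0"
  by (cases w) (auto simp: iso_normal_def vec_eq_iff forall_3 zero_prod_def)

lemma inner_iso_normal:
  "iso_normal w \<bullet> x = 2 * (snd w)\<^sup>2 * x$1 - 2 * fst w * snd w * x$2 + (fst w)\<^sup>2 * x$3"
  by (simp add: iso_normal_def inner_vec_def sum_3)

lemma iso_plane_eq_hyperplane:
  assumes "w \<noteq> 0" shows "iso_plane w = {x. iso_normal w \<bullet> x = 0}"
proof (rule Gr2_subset_eq)
  show "iso_plane w \<subseteq> {x. iso_normal w \<bullet> x = 0}"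
    by (auto simp: iso_plane_def inner_iso_normal power2_eq_square algebra_simps)
qed (simp_all add: assms iso_plane_in_Gr2 hyperplane_in_Gr2 iso_normal_nonzero)

text \<open>The linear form \<open>w\<close> is the common divisor of the forms in its plane, hence unique up to a scalar.\<close>

lemma iso_plane_eqD:
  assumes "w \<noteq> 0" "w' \<noteq> 0" "iso_plane w = iso_plane w'"
  obtains c where "c \<noteq> 0" "w' = c *\<^sub>R w"
proof -
  obtain s t s' t' where st: "w = (s, t)" "w' = (s', t')" by fastforce
  have "sym_mult w' x \<in> {y. iso_normal w \<bullet> y = 0}" for x
    using assms iso_plane_eq_hyperplane[OF assms(1)] by (auto simp: iso_plane_def)
  from this[of "(1, 0)"] this[of "(0, 1)"]
  have "t * (t * s' - s * t') = 0" "s * (t * s' - s * t') = 0"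
    by (auto simp: st inner_iso_normal power2_eq_square algebra_simps)
  moreover have "s \<noteq> 0 \<or> t \<noteq> 0" using assms(1) by (auto simp: st zero_prod_def)
  ultimately have *: "t * s' = s * t'" by (metis mult_eq_0_iff eq_iff_diff_eq_0)
  show ?thesis
  proof (cases "s = 0")
    case True
    with * assms st have "w' = (t' / t) *\<^sub>R w" "t' / t \<noteq> 0" by (auto simp: zero_prod_def)
    then show ?thesis using that by blast
  next
    case False
    with * assms st have "w' = (s' / s) *\<^sub>R w" "s' / s \<noteq> 0"
      by (auto simp: zero_prod_def field_simps)
    then show ?thesis using that by blast
  qed
qed

lemma Q_polar_eq: "Q_polar v w = v$1 * w$3 + v$3 * w$1 - v$2 * w$2"
  by (simp add: Q_polar_def Q_form_def power2_eq_square field_simps)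

text \<open>Vanishing discriminant means being a square up to a scalar. For \<open>v\<^sub>1 \<noteq> 0\<close> completing the square
  shows which one: the form is proportional to \<open>(2 v\<^sub>1 X + v\<^sub>2 Y)\<^sup>2\<close>.\<close>

lemma isotropic_vector_is_square:
  assumes "Q_form v = 0" "v \<noteq> 0"
  obtains w c where "w \<noteq> 0" "c \<noteq> 0" "sym_mult w w = c *\<^sub>R v"
proof (cases "v$1 = 0")
  case True
  with assms have "v$2 = 0" "v$3 \<noteq> 0" by (auto simp: Q_form_def vec_eq_iff forall_3)
  then show ?thesis using True
    by (intro that[of "(0, 1)" "2 / v$3"]) (auto simp: vec_eq_iff forall_3 zero_prod_def)
next
  case False
  with assms(1) show ?thesis
    by (intro that[of "(2 * v$1, v$2)" "4 * v$1"])
      (auto simp: vec_eq_iff forall_3 zero_prod_def Q_form_def power2_eq_square)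
qed

text \<open>A vector spanning the radical of a degenerate plane \<open>p\<close> is orthogonal to itself, hence isotropic, hence a
  multiple of some \<open>w\<^sup>2\<close>; so \<open>p\<close> lies in the orthogonal plane of \<open>w\<^sup>2\<close>, and equals it by dimension.\<close>

lemma isotropic_planes_eq: "isotropic_planes = iso_plane ` {w. w \<noteq> 0}"
proof (intro subset_antisym subsetI)
  fix p assume "p \<in> isotropic_planes"
  then obtain v where p: "p \<in> Gr2" and v: "v \<in> p" "v \<noteq> 0" "\<And>x. x \<in> p \<Longrightarrow> Q_polar v x = 0"
    by (auto simp: isotropic_planes_def)
  have "Q_form v = 0" using v(3)[OF v(1)]
    by (simp add: Q_polar_eq Q_form_def power2_eq_square)
  then obtain w c where w: "w \<noteq> 0" "c \<noteq> 0" "sym_mult w w = c *\<^sub>R v"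
    using v(2) by (rule isotropic_vector_is_square)
  have "iso_normal w \<bullet> x = c * Q_polar v x" for x
  proof -
    have "iso_normal w \<bullet> x = Q_polar (sym_mult w w) x"
      by (simp add: inner_iso_normal Q_polar_eq power2_eq_square algebra_simps)
    then show ?thesis by (simp add: w(3) Q_polar_eq algebra_simps)
  qed
  then have "p \<subseteq> {x. iso_normal w \<bullet> x = 0}" using v(3) by auto
  then have "p = iso_plane w"
    using p w(1) by (metis Gr2_subset_eq iso_plane_eq_hyperplane iso_plane_in_Gr2)
  with w(1) show "p \<in> iso_plane ` {w. w \<noteq> 0}" by auto
next
  fix p assume "p \<in> iso_plane ` {w. w \<noteq> 0}"
  then obtain w where w: "w \<noteq> 0" "p = iso_plane w" by auto
  have "sym_mult w w \<noteq> 0" using w(1) by (cases w) (auto simp: vec_eq_iff forall_3 zero_prod_def)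
  moreover have "Q_polar (sym_mult w w) (sym_mult w x) = 0" for x
    by (simp add: Q_polar_eq algebra_simps)
  moreover have "p = range (sym_mult w)" "p \<in> Gr2" using w iso_plane_in_Gr2 by (auto simp: iso_plane_def)
  ultimately show "p \<in> isotropic_planes" unfolding isotropic_planes_def by blast
qed

section \<open>The section and its continuity\<close>

text \<open>An element of \<open>SL\<^sub>3(\<real>)\<close> taking the standard lattice to the lattice of \<open>w\<close>. The first two columns are
  the images of the standard basis of \<open>\<int>\<^sup>2\<close>; their cross product is \<^term>\<open>iso_normal w\<close>, and the
  multiple of it in the third column is chosen to make the determinant \<open>1\<close>.\<close>

definition frame :: "real \<times> real \<Rightarrow> real^3^3" where
  "frame w = vector
     [vector [fst w, 0, iso_normal w $ 1 / (iso_normal w \<bullet> iso_normal w)],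
      vector [snd w, fst w, iso_normal w $ 2 / (iso_normal w \<bullet> iso_normal w)],
      vector [0, 2 * snd w, iso_normal w $ 3 / (iso_normal w \<bullet> iso_normal w)]]"

lemma det_frame:
  assumes "w \<noteq> 0" shows "det (frame w) = 1"
proof -
  define D where "D = iso_normal w \<bullet> iso_normal w"
  have "D \<noteq> 0" using iso_normal_nonzero[OF assms] by (simp add: D_def)
  have "D = 4 * (snd w)^4 + 4 * (fst w)\<^sup>2 * (snd w)\<^sup>2 + (fst w)^4"
    by (simp add: D_def iso_normal_def inner_vec_def sum_3 power2_eq_square power4_eq_xxxx)
  moreover have "det (frame w) * D = 4 * (snd w)^4 + 4 * (fst w)\<^sup>2 * (snd w)\<^sup>2 + (fst w)^4"
    using \<open>D \<noteq> 0\<close>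
    unfolding frame_def D_def[symmetric]
    by (simp add: det_3 iso_normal_def field_simps power2_eq_square power4_eq_xxxx)
  ultimately show ?thesis using \<open>D \<noteq> 0\<close> by simp
qed

lemma frame_mult:
  "frame w *v e1 = sym_mult w (1, 0)" "frame w *v e2 = sym_mult w (0, 1)"
  by (simp_all add: frame_def vec_eq_iff forall_3 matrix_vector_mult_def sum_3
      e1_def e2_def axis_def)

lemma Gr2_act_frame: "Gr2_act (frame w) base_plane = iso_plane w"
  by (simp add: Gr2_act_def base_plane_def iso_plane_eq_span frame_mult flip: linear_span_image)

lemma X_act_frame:
  assumes "w \<noteq> 0"
  shows "X_act (frame w) base_lattice = homothety `` {iso_lattice w}"
  by (simp add: base_lattice_def X_act_class[OF det_frame[OF assms] int_span2_e1_e2]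
      linear_image_int_span2 frame_mult iso_lattice_eq_int_span2)

definition circle_point :: "real \<Rightarrow> real \<times> real" where
  "circle_point \<theta> = (cos \<theta>, sin \<theta>)"

lemma circle_point_nonzero: "circle_point \<theta> \<noteq> 0"
  using sin_zero_abs_cos_one[of \<theta>] by (auto simp: circle_point_def zero_prod_def)

lemma continuous_map_frame_circle: "continuous_map euclideanreal SL3_top (\<lambda>\<theta>. frame (circle_point \<theta>))"
proof -
  have "continuous_on UNIV (\<lambda>\<theta>. frame (circle_point \<theta>) $ i $ j)" for i j
  proof -
    have "continuous_on UNIV (\<lambda>\<theta>. iso_normal (circle_point \<theta>) $ k)" for k
      using exhaust_3[of k]
      by (elim disjE; simp add: iso_normal_def circle_point_def; intro continuous_intros)
    then have "continuous_on UNIV (\<lambda>\<theta>. \<chi> k. iso_normal (circle_point \<theta>) $ k)"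
      by (intro continuous_on_vec_lambda)
    then have normal: "continuous_on UNIV (\<lambda>\<theta>. iso_normal (circle_point \<theta>))" by simp
    have "continuous_on UNIV (\<lambda>\<theta>. iso_normal (circle_point \<theta>) $ k
        / (iso_normal (circle_point \<theta>) \<bullet> iso_normal (circle_point \<theta>)))" for k
      by (intro continuous_on_divide continuous_on_component continuous_on_inner normal)
        (simp add: iso_normal_nonzero circle_point_nonzero)
    moreover have "continuous_on UNIV (\<lambda>\<theta>. fst (circle_point \<theta>))"
      "continuous_on UNIV (\<lambda>\<theta>. snd (circle_point \<theta>))"
      "continuous_on UNIV (\<lambda>\<theta>. 2 * snd (circle_point \<theta>))"
      by (auto simp: circle_point_def intro!: continuous_intros)
    ultimately show ?thesis
      using exhaust_3[of i] exhaust_3[of j]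
      by (elim disjE) (simp_all add: frame_def)
  qed
  then have "continuous_on UNIV (\<lambda>\<theta>. \<chi> i j. frame (circle_point \<theta>) $ i $ j)"
    by (intro continuous_on_vec_lambda)
  then show ?thesis
    by (auto simp: SL3_top_def continuous_map_in_subtopology det_frame circle_point_nonzero)
qed

definition circle_plane :: "real \<Rightarrow> (real^3) set" where
  "circle_plane \<theta> = iso_plane (circle_point \<theta>)"

lemma continuous_map_circle_plane: "continuous_map euclideanreal Gr2_top circle_plane"
  using continuous_map_compose[OF continuous_map_frame_circle continuous_map_Gr2_orbit]
  by (simp add: o_def Gr2_act_frame circle_plane_def[abs_def])

lemma circle_plane_image: "circle_plane ` {0..2 * pi} = isotropic_planes"
proof (intro subset_antisym subsetI)
  fix p assume "p \<in> isotropic_planes"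
  then obtain w where w: "w \<noteq> 0" "p = iso_plane w" by (auto simp: isotropic_planes_eq)
  let ?w = "(1 / norm w) *\<^sub>R w"
  have "norm ?w = 1" using w(1) by simp
  then have "(fst ?w)\<^sup>2 + (snd ?w)\<^sup>2 = 1"
    unfolding norm_prod_def real_norm_def power2_abs by (metis real_sqrt_eq_1_iff)
  then obtain \<theta> where \<theta>: "0 \<le> \<theta>" "\<theta> < 2 * pi" "fst ?w = cos \<theta>" "snd ?w = sin \<theta>"
    by (rule sincos_total_2pi)
  then have "?w = circle_point \<theta>" by (simp add: circle_point_def prod_eq_iff)
  then have "p = circle_plane \<theta>"
    unfolding circle_plane_def w(2) using w(1) by (metis iso_plane_scaleR divide_eq_0_iff norm_eq_zero one_neq_zero)
  with \<theta> show "p \<in> circle_plane ` {0..2 * pi}" by auto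
qed (auto simp: isotropic_planes_eq circle_plane_def circle_point_nonzero)

lemma circle_plane_in_isotropic_planes: "circle_plane \<theta> \<in> isotropic_planes"
  by (auto simp: isotropic_planes_eq circle_plane_def circle_point_nonzero)

lemma isotropic_planes_subset_Gr2: "isotropic_planes \<subseteq> Gr2"
  by (auto simp: isotropic_planes_def)

text \<open>A continuous surjection from a compact space to a Hausdorff space is a quotient map. So a map on the
  isotropic planes is continuous as soon as it is continuous in the angle.\<close>

lemma quotient_map_circle_plane:
  "quotient_map (top_of_set {0..2 * pi}) (subtopology Gr2_top isotropic_planes) circle_plane"
proof (rule continuous_imp_quotient_map)
  show "continuous_map (top_of_set {0..2 * pi}) (subtopology Gr2_top isotropic_planes) circle_plane"
    using continuous_map_from_subtopology[OF continuous_map_circle_plane]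
    by (simp add: continuous_map_in_subtopology circle_plane_in_isotropic_planes)
  show "compact_space (top_of_set {0..2 * pi})" by (simp add: compact_space_subtopology)
  show "Hausdorff_space (subtopology Gr2_top isotropic_planes)"
    by (rule Hausdorff_space_subtopology[OF Hausdorff_Gr2_top])
  show "circle_plane ` topspace (top_of_set {0..2 * pi}) = topspace (subtopology Gr2_top isotropic_planes)"
    using isotropic_planes_subset_Gr2 by (simp add: circle_plane_image Int_absorb1)
qed

lemma compactin_isotropic_planes: "compactin Gr2_top isotropic_planes"
  unfolding circle_plane_image[symmetric]
  by (rule image_compactin[OF _ continuous_map_circle_plane]) simp

text \<open>Any choice of \<open>w\<close> gives the same class, because \<open>w\<close> is unique up to scaling and rescaling \<open>w\<close>
  rescales its lattice.\<close>

definition iso_section :: "(real^3) set \<Rightarrow> (real^3) set set" where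
  "iso_section p = homothety `` {iso_lattice (SOME w. w \<noteq> 0 \<and> p = iso_plane w)}"

lemma iso_section_iso_plane:
  assumes "w \<noteq> 0" shows "iso_section (iso_plane w) = homothety `` {iso_lattice w}"
proof -
  let ?w = "SOME w'. w' \<noteq> 0 \<and> iso_plane w = iso_plane w'"
  have "?w \<noteq> 0 \<and> iso_plane w = iso_plane ?w"
    by (rule someI[of "\<lambda>w'. w' \<noteq> 0 \<and> iso_plane w = iso_plane w'" w]) (simp add: assms)
  then obtain c where "c \<noteq> 0" "?w = c *\<^sub>R w" using iso_plane_eqD[OF assms] by blast
  then show ?thesis
    by (simp add: iso_section_def iso_lattice_scaleR homothety_class_scale
        iso_lattice_in_lattices2 assms)
qed

lemma continuous_map_iso_section:
  "continuous_map (subtopology Gr2_top isotropic_planes) X_top iso_section"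
proof (rule continuous_compose_quotient_map[OF quotient_map_circle_plane])
  have "continuous_map euclideanreal X_top (\<lambda>\<theta>. X_act (frame (circle_point \<theta>)) base_lattice)"
    using continuous_map_compose[OF continuous_map_frame_circle continuous_map_X_orbit]
    by (simp add: o_def)
  also have "(\<lambda>\<theta>. X_act (frame (circle_point \<theta>)) base_lattice) = iso_section \<circ> circle_plane"
    by (simp add: fun_eq_iff X_act_frame circle_plane_def iso_section_iso_plane circle_point_nonzero)
  finally show "continuous_map (top_of_set {0..2 * pi}) X_top (iso_section \<circ> circle_plane)"
    by (rule continuous_map_from_subtopology)
qed

lemma X_proj_iso_section:
  assumes "p \<in> isotropic_planes" shows "X_proj (iso_section p) = p"
  using assms by (auto simp: isotropic_planes_eq iso_section_iso_plane X_proj_class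
      iso_lattice_in_lattices2 span_iso_lattice)

section \<open>Equivariance under \<open>\<Gamma>\<^sub>0\<close>\<close>

text \<open>The matrix \<open>g\<close> is the effect on products of a substitution \<open>A\<close> of linear forms that preserves \<open>\<int>\<^sup>2\<close>.
  The inverse \<open>B\<close> is carried along so that the relation is visibly symmetric under inversion and thus
  passes from generators to the group.\<close>

definition lifts_to :: "real^3^3 \<Rightarrow> (real \<times> real \<Rightarrow> real \<times> real) \<Rightarrow> (real \<times> real \<Rightarrow> real \<times> real) \<Rightarrow> bool" where
  "lifts_to g A B \<longleftrightarrow> (\<forall>w x. g *v sym_mult w x = sym_mult (A w) (A x)) \<and>
     A ` int_pairs \<subseteq> int_pairs \<and> B ` int_pairs \<subseteq> int_pairs \<and>
     (\<forall>w. A (B w) = w) \<and> (\<forall>w. B (A w) = w) \<and> A 0 = 0"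

lemma int_pairsI: "m \<in> \<int> \<Longrightarrow> n \<in> \<int> \<Longrightarrow> (m, n) \<in> int_pairs"
  by (auto simp: int_pairs_def Ints_def)

lemma int_pairsE:
  assumes "x \<in> int_pairs" obtains m n where "x = (m, n)" "m \<in> \<int>" "n \<in> \<int>"
  using assms by (auto simp: int_pairs_def)

lemma lifts_toD:
  assumes "lifts_to g A B"
  shows "g *v sym_mult w x = sym_mult (A w) (A x)" "A (B w) = w" "B (A w) = w" "A 0 = 0"
    "A ` int_pairs \<subseteq> int_pairs" "B ` int_pairs \<subseteq> int_pairs"
  using assms unfolding lifts_to_def by blast+

text \<open>The two generators come from the elementary substitutions
  \<open>(w\<^sub>1, w\<^sub>2) \<mapsto> (w\<^sub>1 + 2 w\<^sub>2, w\<^sub>2)\<close> and \<open>(w\<^sub>1, w\<^sub>2) \<mapsto> (w\<^sub>1, w\<^sub>1 + w\<^sub>2)\<close>.\<close>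

lemma lifts_u_plus:
  "lifts_to u_plus (\<lambda>w. (fst w + 2 * snd w, snd w)) (\<lambda>w. (fst w - 2 * snd w, snd w))"
  by (auto simp: lifts_to_def u_plus_def vec_eq_iff forall_3 matrix_vector_mult_def sum_3
      zero_prod_def algebra_simps elim!: int_pairsE intro!: int_pairsI)

lemma lifts_u_minus:
  "lifts_to u_minus (\<lambda>w. (fst w, fst w + snd w)) (\<lambda>w. (fst w, snd w - fst w))"
  by (auto simp: lifts_to_def u_minus_def vec_eq_iff forall_3 matrix_vector_mult_def sum_3
      zero_prod_def algebra_simps elim!: int_pairsE intro!: int_pairsI)

lemma det_u: "det u_plus = 1" "det u_minus = 1"
  by (simp_all add: u_plus_def u_minus_def det_3)

lemma Gamma0_subset_SL3: "Gamma0 \<subseteq> carrier SL3"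
  unfolding Gamma0_def by (rule SL3.generate_incl) (auto simp: det_u)

lemma lifts_to_inverse:
  assumes "lifts_to g A B" "h ** g = mat 1" shows "lifts_to h B A"
proof -
  have "h *v sym_mult w x = sym_mult (B w) (B x)" for w x
  proof -
    have "sym_mult w x = g *v sym_mult (B w) (B x)" by (simp only: lifts_toD[OF assms(1)])
    then show ?thesis by (simp add: matrix_vector_mul_assoc assms(2))
  qed
  moreover have "B 0 = 0" using lifts_toD(3)[OF assms(1), of 0] by (simp only: lifts_toD(4)[OF assms(1)])
  ultimately show ?thesis using lifts_toD[OF assms(1)] unfolding lifts_to_def by blast
qed

lemma lifts_to_mult:
  assumes "lifts_to g A B" "lifts_to h A' B'" shows "lifts_to (g ** h) (A \<circ> A') (B' \<circ> B)"
  using assms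
  by (simp add: lifts_to_def matrix_vector_mul_assoc[symmetric] image_subset_iff
      del: split_paired_All)

lemma Gamma0_lifts:
  assumes "g \<in> Gamma0" shows "\<exists>A B. lifts_to g A B"
  using assms unfolding Gamma0_def
proof (induction rule: generate.induct)
  case one
  have "lifts_to (mat 1) id id" by (simp add: lifts_to_def)
  then show ?case by auto
next
  case (incl h)
  then show ?case using lifts_u_plus lifts_u_minus by auto
next
  case (inv h)
  then have h: "h \<in> carrier SL3" by (auto simp: det_u)
  from inv obtain A B where "lifts_to h A B" using lifts_u_plus lifts_u_minus by auto
  moreover have "inv\<^bsub>SL3\<^esub> h ** h = mat 1" using SL3.l_inv[OF h] by simp
  ultimately show ?case using lifts_to_inverse by blast
next
  case (eng g h)
  then show ?case using lifts_to_mult by (metis mult_SL3)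
qed

text \<open>Since \<open>g (w \<cdot> x) = A w \<cdot> A x\<close> and \<open>A\<close> maps \<open>\<real>\<^sup>2\<close> and \<open>\<int>\<^sup>2\<close> onto themselves, \<open>g\<close> moves both the plane and
  the lattice of \<open>w\<close> to those of \<open>A w\<close>.\<close>

lemma lifts_to_image:
  assumes "lifts_to g A B"
  shows "(*v) g ` iso_plane w = iso_plane (A w)" "(*v) g ` iso_lattice w = iso_lattice (A w)"
    and "w \<noteq> 0 \<Longrightarrow> A w \<noteq> 0"
proof -
  note A = lifts_toD[OF assms]
  have "A ` UNIV = UNIV" using A(2) by (rule surjI)
  moreover have "int_pairs \<subseteq> A ` int_pairs"
    using A(2,6) by (metis image_eqI image_subset_iff subsetI)
  with A(5) have "A ` int_pairs = int_pairs" by (rule subset_antisym)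
  moreover have "(*v) g ` sym_mult w ` S = sym_mult (A w) ` A ` S" for S
    by (simp only: image_image A(1))
  ultimately show "(*v) g ` iso_plane w = iso_plane (A w)" "(*v) g ` iso_lattice w = iso_lattice (A w)"
    by (simp_all add: iso_plane_def iso_lattice_def)
  show "A w \<noteq> 0" if "w \<noteq> 0" using A(3,4) that by metis
qed

lemma Gamma0_equivariant:
  assumes "g \<in> Gamma0" "p \<in> isotropic_planes"
  shows "Gr2_act g p \<in> isotropic_planes" "iso_section (Gr2_act g p) = X_act g (iso_section p)"
proof -
  have g: "det g = 1" using Gamma0_subset_SL3 assms(1) by auto
  obtain A B where A: "lifts_to g A B" using Gamma0_lifts[OF assms(1)] by blast
  obtain w where w: "w \<noteq> 0" "p = iso_plane w" using assms(2) by (auto simp: isotropic_planes_eq)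
  have p: "Gr2_act g p = iso_plane (A w)" by (simp add: Gr2_act_def w lifts_to_image[OF A])
  then show "Gr2_act g p \<in> isotropic_planes" using lifts_to_image(3)[OF A w(1)]
    by (auto simp: isotropic_planes_eq)
  have "iso_section (Gr2_act g p) = homothety `` {iso_lattice (A w)}"
    by (simp only: p iso_section_iso_plane[OF lifts_to_image(3)[OF A w(1)]])
  also have "\<dots> = X_act g (iso_section p)"
    by (simp add: w(2) iso_section_iso_plane w(1) lifts_to_image[OF A] X_act_class[OF g]
        iso_lattice_in_lattices2)
  finally show "iso_section (Gr2_act g p) = X_act g (iso_section p)" .
qed

lemma equivariant_section_iso_section: "equivariant_section iso_section"
  by (simp add: equivariant_section_def continuous_map_iso_section Gamma0_equivariant
      X_proj_iso_section)

text \<open>Every element of the generated subgroup is the product of a finite word in the generators and their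
  inverses.\<close>

lemma (in group) countable_generate:
  assumes "countable S" "S \<subseteq> carrier G" shows "countable (generate G S)"
proof -
  let ?T = "S \<union> (\<lambda>x. inv x) ` S" and ?prod = "\<lambda>xs. foldr (\<otimes>) xs \<one>"
  have T: "?T \<subseteq> carrier G" using assms(2) by auto
  have closed: "?prod xs \<in> carrier G" if "xs \<in> lists ?T" for xs
    using that T by (induction xs) auto
  have append: "?prod (xs @ ys) = ?prod xs \<otimes> ?prod ys" if "xs \<in> lists ?T" "ys \<in> lists ?T" for xs ys
    using that(1) T closed[OF that(2)]
    by (induction xs) (auto simp: m_assoc closed subset_eq in_lists_conv_set)
  have "generate G S \<subseteq> ?prod ` lists ?T"
  proof
    fix g assume "g \<in> generate G S"
    then show "g \<in> ?prod ` lists ?T"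
    proof (induction rule: generate.induct)
      case one
      show ?case by (rule image_eqI[of _ _ "[]"]) auto
    next
      case (incl h)
      then show ?case using T by (intro image_eqI[of _ _ "[h]"]) auto
    next
      case (inv h)
      then show ?case using T by (intro image_eqI[of _ _ "[inv h]"]) auto
    next
      case (eng g h)
      then obtain xs ys where "xs \<in> lists ?T" "ys \<in> lists ?T" "g = ?prod xs" "h = ?prod ys" by blast
      then show ?case by (intro image_eqI[of _ _ "xs @ ys"]) (simp_all only: append append_in_lists_conv conj_absorb)
    qed
  qed
  moreover have "countable (?prod ` lists ?T)" using assms(1) by auto
  ultimately show ?thesis by (rule countable_subset)
qed

lemma countable_Gamma0: "countable Gamma0"
  unfolding Gamma0_def by (rule SL3.countable_generate) (auto simp: det_u)

section \<open>Borel measures on topological spaces\<close>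

lemma space_borel_of [simp]: "space (borel_of T) = topspace T"
  unfolding borel_of_def by (intro space_measure_of) (auto dest: openin_subset)

lemma sets_borel_of: "sets (borel_of T) = sigma_sets (topspace T) {U. openin T U}"
  unfolding borel_of_def by (intro sets_measure_of) (auto dest: openin_subset)

lemma openin_borel_of: "openin T U \<Longrightarrow> U \<in> sets (borel_of T)"
  by (simp add: sets_borel_of sigma_sets.Basic)

lemma closedin_borel_of:
  assumes "closedin T C" shows "C \<in> sets (borel_of T)"
proof -
  have "space (borel_of T) - (topspace T - C) \<in> sets (borel_of T)"
    using assms by (intro sets.compl_sets openin_borel_of) (simp add: openin_diff)
  moreover have "C \<subseteq> topspace T" using assms by (rule closedin_subset)
  ultimately show ?thesis by (simp add: double_diff)
qed

lemma measurable_borel_of: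
  assumes "continuous_map T T' f" shows "f \<in> borel_of T \<rightarrow>\<^sub>M borel_of T'"
proof (rule measurable_sigma_sets[OF sets_borel_of])
  show "f \<in> space (borel_of T) \<rightarrow> topspace T'" using assms by (simp add: continuous_map_def)
  fix U assume "U \<in> {U. openin T' U}"
  then have "openin T {x \<in> topspace T. f x \<in> U}" using assms by (simp add: continuous_map_def)
  then show "f -` U \<inter> space (borel_of T) \<in> sets (borel_of T)"
    by (auto dest: openin_borel_of simp: vimage_def Int_def conj_commute)
qed (auto dest: openin_subset)

lemma sets_borel_of_euclidean: "sets (borel_of euclidean) = sets borel"
  by (simp add: sets_borel_of borel_def)

lemma borel_measurable_borel_of:
  assumes "continuous_map T euclidean f" shows "f \<in> borel_measurable (borel_of T)"
  using measurable_borel_of[OF assms] by (simp cong: measurable_cong_sets add: sets_borel_of_euclidean)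

lemma borel_prob_measureD:
  assumes "borel_prob_measure T \<nu>"
  shows "prob_space \<nu>" "sets \<nu> = sets (borel_of T)" "space \<nu> = topspace T"
  using assms sets_eq_imp_space_eq[of \<nu> "borel_of T"] by (auto simp: borel_prob_measure_def)

lemma borel_prob_measure_distr:
  assumes "prob_space N" "f \<in> N \<rightarrow>\<^sub>M borel_of T" shows "borel_prob_measure T (distr N (borel_of T) f)"
  using assms by (simp add: borel_prob_measure_def prob_space.prob_space_distr)

lemma borel_prob_measure_eqI_openin:
  assumes "borel_prob_measure T N1" "borel_prob_measure T N2"
    and "\<And>U. openin T U \<Longrightarrow> emeasure N1 U = emeasure N2 U"
  shows "N1 = N2"
proof (rule measure_eqI_generator_eq[where E = "{U. openin T U}" and \<Omega> = "topspace T"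
      and A = "\<lambda>_. topspace T"])
  interpret prob_space N1 using assms(1) by (rule borel_prob_measureD)
  show "emeasure N1 (topspace T) \<noteq> \<infinity>" by simp
qed (use assms in \<open>auto simp: Int_stable_def sets_borel_of dest: borel_prob_measureD openin_subset\<close>)

lemma borel_prob_measure_eqI_closedin:
  assumes "borel_prob_measure T N1" "borel_prob_measure T N2"
    and "\<And>A. closedin T A \<Longrightarrow> measure N1 A = measure N2 A"
  shows "N1 = N2"
proof (rule borel_prob_measure_eqI_openin[OF assms(1,2)])
  interpret N1: prob_space N1 using assms(1) by (rule borel_prob_measureD)
  interpret N2: prob_space N2 using assms(2) by (rule borel_prob_measureD)
  note N = borel_prob_measureD(2,3)[OF assms(1)] borel_prob_measureD(2,3)[OF assms(2)]
  fix U assume U: "openin T U"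
  let ?A = "topspace T - U"
  have A: "closedin T ?A" using U by (rule closedin_diff[OF closedin_topspace])
  have "U = topspace T - ?A" using openin_subset[OF U] by auto
  then have "measure N1 U = 1 - measure N1 ?A" "measure N2 U = 1 - measure N2 ?A"
    using N1.prob_compl[of ?A] N2.prob_compl[of ?A] closedin_borel_of[OF A] by (simp_all add: N)
  with assms(3)[OF A] show "emeasure N1 U = emeasure N2 U"
    by (simp add: N1.emeasure_eq_measure N2.emeasure_eq_measure)
qed

lemma continuous_map_tent:
  fixes F :: "'a \<Rightarrow> 'b::metric_space"
  assumes "continuous_map T euclidean F"
  shows "continuous_map T euclideanreal (\<lambda>x. max 0 (1 - real n * infdist (F x) S))"
proof -
  have "continuous_on UNIV (\<lambda>y. max 0 (1 - real n * infdist y S))"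
    by (intro continuous_intros)
  then have "continuous_map T euclideanreal ((\<lambda>y. max 0 (1 - real n * infdist y S)) \<circ> F)"
    by (intro continuous_map_compose[OF assms]) simp
  then show ?thesis by (simp add: o_def)
qed

text \<open>For a measure carried by the compact set \<open>K\<close>, the measure of a closed set \<open>A\<close> is recovered from
  continuous functions. As \<open>F\<close> is injective, the image of \<open>A \<inter> K\<close> is a compact set that \<open>F x\<close>, for
  \<open>x \<in> K\<close>, meets only if \<open>x \<in> A\<close>; the tents of slope \<open>n\<close> over it decrease to the indicator of \<open>A\<close> on \<open>K\<close>.
  If \<open>A\<close> misses \<open>K\<close>, the distance to the empty image has the default value \<open>0\<close>, whence the hypothesis
  \<open>A \<inter> K \<noteq> {}\<close>.\<close>

lemma measure_compact_eq_lim: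
  fixes F :: "'a \<Rightarrow> 'b::metric_space"
  assumes F: "continuous_map T euclidean F" "inj_on F (topspace T)"
    and N: "borel_prob_measure T N" and K: "compactin T K" "AE x in N. x \<in> K"
    and A: "closedin T A" "A \<inter> K \<noteq> {}"
  shows "(\<lambda>n. \<integral>x. max 0 (1 - real n * infdist (F x) (F ` (A \<inter> K))) \<partial>N) \<longlonglongrightarrow> measure N A"
proof -
  interpret prob_space N using N by (rule borel_prob_measureD)
  note N' = borel_prob_measureD(2,3)[OF N]
  define S where "S = F ` (A \<inter> K)"
  have "compactin T (A \<inter> K)" using A K by (simp add: closed_Int_compactin)
  then have "compact S" using image_compactin F(1) unfolding S_def by fastforce
  then have S: "closed S" "S \<noteq> {}" using A(2) by (auto simp: S_def compact_imp_closed)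
  have lim: "(\<lambda>n. max 0 (1 - real n * infdist (F x) S)) \<longlonglongrightarrow> indicator A x" if "x \<in> K" for x
  proof (cases "x \<in> A")
    case True
    then have "infdist (F x) S = 0" using that by (auto simp: S_def)
    then show ?thesis using True by simp
  next
    case False
    have "F x \<notin> S"
    proof
      assume "F x \<in> S"
      then obtain y where "y \<in> A" "y \<in> K" "F x = F y" by (auto simp: S_def)
      moreover have "K \<subseteq> topspace T" using K(1) by (rule compactin_subset_topspace)
      ultimately have "x = y" using F(2) that by (meson inj_onD subsetD)
      with \<open>y \<in> A\<close> False show False by simp
    qed
    then have pos: "0 < infdist (F x) S" using S infdist_pos_not_in_closed by blast
    obtain n0 :: nat where n0: "1 < real n0 * infdist (F x) S"
      using reals_Archimedean3[OF pos] by blast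
    have "1 < real n * infdist (F x) S" if "n \<ge> n0" for n
      using mult_right_mono[of "real n0" "real n", OF _ less_imp_le[OF pos]] n0 that by simp
    then have "eventually (\<lambda>n. max 0 (1 - real n * infdist (F x) S) = 0) sequentially"
      by (intro eventually_sequentiallyI[of n0]) (simp add: less_imp_le)
    then show ?thesis using False by (simp add: tendsto_eventually)
  qed
  have "(\<lambda>n. \<integral>x. max 0 (1 - real n * infdist (F x) S) \<partial>N) \<longlonglongrightarrow> (\<integral>x. indicator A x \<partial>N)"
  proof (rule integral_dominated_convergence[where w = "\<lambda>_. 1"])
    show "AE x in N. (\<lambda>n. max 0 (1 - real n * infdist (F x) S)) \<longlonglongrightarrow> indicator A x"
      using K(2) by eventually_elim (rule lim)
    show "(\<lambda>x. max 0 (1 - real n * infdist (F x) S)) \<in> borel_measurable N" for n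
      using borel_measurable_borel_of[OF continuous_map_tent[OF F(1)]] by (simp cong: measurable_cong_sets add: N')
    show "AE x in N. norm (max 0 (1 - real n * infdist (F x) S)) \<le> 1" for n
      by (intro AE_I2) (simp add: infdist_nonneg)
    show "indicator A \<in> borel_measurable N"
      using closedin_borel_of[OF A(1)] by (intro borel_measurable_indicator) (simp add: N')
  qed simp
  also have "(\<integral>x. indicator A x \<partial>N) = measure N A"
    using closedin_subset[OF A(1)] by (simp add: N' Int_absorb1 Int_absorb2)
  finally show ?thesis by (simp add: S_def)
qed

lemma borel_prob_measure_eqI_continuous:
  fixes F :: "'a \<Rightarrow> 'b::metric_space"
  assumes F: "continuous_map T euclidean F" "inj_on F (topspace T)" and K: "compactin T K"
    and N1: "borel_prob_measure T N1" "AE x in N1. x \<in> K"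
    and N2: "borel_prob_measure T N2" "AE x in N2. x \<in> K"
    and eq: "\<And>f :: 'a \<Rightarrow> real. continuous_map T euclidean f \<Longrightarrow> (\<And>x. \<bar>f x\<bar> \<le> 1) \<Longrightarrow>
      integral\<^sup>L N1 f = integral\<^sup>L N2 f"
  shows "N1 = N2"
proof (rule borel_prob_measure_eqI_closedin[OF N1(1) N2(1)])
  fix A assume A: "closedin T A"
  show "measure N1 A = measure N2 A"
  proof (cases "A \<inter> K = {}")
    case True
    have "measure N A = 0" if "borel_prob_measure T N" "AE x in N. x \<in> K" for N
    proof -
      have "AE x in N. x \<notin> A" using that(2) by eventually_elim (use True in auto)
      then have "emeasure N A = 0"
        using closedin_borel_of[OF A] closedin_subset[OF A] borel_prob_measureD(2,3)[OF that(1)]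
        by (subst (asm) AE_iff_measurable[OF _ refl]) (auto simp: Int_absorb1 Collect_conj_eq Int_def[symmetric])
      then show ?thesis by (simp add: measure_def)
    qed
    with N1 N2 show ?thesis by simp
  next
    case False
    let ?f = "\<lambda>n x. max 0 (1 - real n * infdist (F x) (F ` (A \<inter> K)))"
    have "integral\<^sup>L N1 (?f n) = integral\<^sup>L N2 (?f n)" for n
      by (rule eq[OF continuous_map_tent[OF F(1)]]) (simp add: infdist_nonneg)
    then show ?thesis
      using measure_compact_eq_lim[OF F N1(1) K N1(2) A False]
        measure_compact_eq_lim[OF F N2(1) K N2(2) A False] LIMSEQ_unique by simp
  qed
qed

text \<open>A probability measure carried by a countable set of measurable points is discrete. Since the integral
  over a discrete measure sees only the values at the atoms, the two integrals agree for every
  function, measurable or not; this frees the definition of stationarity from measurability in the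
  group variable.\<close>

lemma countable_support_pmf:
  assumes "prob_space \<mu>" "countable S" and sets: "\<And>g. g \<in> S \<Longrightarrow> {g} \<in> sets \<mu>"
    and AE: "AE g in \<mu>. g \<in> S"
  obtains M where "set_pmf M \<subseteq> S" "\<And>F :: 'a \<Rightarrow> ennreal. (\<integral>\<^sup>+g. F g \<partial>\<mu>) = (\<integral>\<^sup>+g. F g \<partial>M)"
proof -
  interpret prob_space \<mu> by fact
  have int: "(\<integral>\<^sup>+g. F g \<partial>\<mu>) = (\<integral>\<^sup>+g. F g * emeasure \<mu> {g} \<partial>count_space S)" for F :: "'a \<Rightarrow> ennreal"
  proof -
    have "(\<integral>\<^sup>+g. F g \<partial>\<mu>) = (\<integral>\<^sup>+x. (\<integral>\<^sup>+g. F g * indicator {g} x \<partial>count_space S) \<partial>\<mu>)"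
    proof (rule nn_integral_cong_AE)
      show "AE x in \<mu>. F x = (\<integral>\<^sup>+g. F g * indicator {g} x \<partial>count_space S)"
        using AE
      proof eventually_elim
        fix x assume "x \<in> S"
        have "(\<integral>\<^sup>+g. F g * indicator {g} x \<partial>count_space S) = (\<integral>\<^sup>+g. F x * indicator {x} g \<partial>count_space S)"
          by (intro nn_integral_cong) (auto simp: indicator_def)
        also have "\<dots> = F x" using \<open>x \<in> S\<close> by (simp add: nn_integral_cmult_indicator)
        finally show "F x = (\<integral>\<^sup>+g. F g * indicator {g} x \<partial>count_space S)" by simp
      qed
    qed
    also have "\<dots> = (\<integral>\<^sup>+g. (\<integral>\<^sup>+x. F g * indicator {g} x \<partial>\<mu>) \<partial>count_space S)"
      using assms(2) sets by (intro nn_integral_count_space_nn_integral) auto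
    also have "\<dots> = (\<integral>\<^sup>+g. F g * emeasure \<mu> {g} \<partial>count_space S)"
      using sets by (intro nn_integral_cong nn_integral_cmult_indicator) auto
    finally show ?thesis .
  qed
  let ?p = "\<lambda>g. measure \<mu> {g} * indicator S g"
  define M where "M = embed_pmf ?p"
  have "(\<integral>\<^sup>+g. ennreal (?p g) \<partial>count_space UNIV) = (\<integral>\<^sup>+g. 1 * emeasure \<mu> {g} \<partial>count_space S)"
    by (subst nn_integral_count_space_indicator)
      (auto intro!: nn_integral_cong simp: emeasure_eq_measure ennreal_mult indicator_def)
  also have "\<dots> = 1" using int[of "\<lambda>_. 1"] emeasure_space_1 by simp
  finally have M: "pmf M g = ?p g" for g
    unfolding M_def by (intro pmf_embed_pmf) auto
  show ?thesis
  proof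
    show "set_pmf M \<subseteq> S" by (auto simp: set_pmf_eq M indicator_def split: if_splits)
    fix F :: "'a \<Rightarrow> ennreal"
    have "(\<integral>\<^sup>+g. F g \<partial>M) = (\<integral>\<^sup>+g. ennreal (pmf M g) * F g \<partial>count_space UNIV)"
      by (rule nn_integral_measure_pmf)
    also have "\<dots> = (\<integral>\<^sup>+g. F g * emeasure \<mu> {g} \<partial>count_space S)"
      by (subst (2) nn_integral_count_space_indicator)
        (auto intro!: nn_integral_cong simp: M emeasure_eq_measure ennreal_mult indicator_def mult_ac)
    finally show "(\<integral>\<^sup>+g. F g \<partial>\<mu>) = (\<integral>\<^sup>+g. F g \<partial>M)" by (simp add: int)
  qed
qed

text \<open>In a second countable space the complement of the support is covered by countably many null sets of a
  basis.\<close>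

lemma AE_in_measure_support:
  fixes S :: "'a::second_countable_topology set"
  assumes "borel_prob_measure (top_of_set S) \<mu>"
  shows "AE x in \<mu>. x \<in> measure_support (top_of_set S) \<mu>"
proof -
  note \<mu> = borel_prob_measureD(2,3)[OF assms]
  obtain B :: "'a set set" where B: "countable B" "topological_basis B"
    using ex_countable_basis by blast
  let ?N = "{b \<in> B. emeasure \<mu> (S \<inter> b) = 0}"
  have open_sets: "S \<inter> b \<in> sets \<mu>" if "open b" for b
    unfolding \<mu> by (intro openin_borel_of) (simp add: openin_open_Int that)
  have "(\<Union>b\<in>?N. S \<inter> b) \<in> null_sets \<mu>"
    using B by (intro null_sets_UN') (auto simp: null_sets_def open_sets topological_basis_open)
  moreover have "{x \<in> space \<mu>. x \<notin> measure_support (top_of_set S) \<mu>} \<subseteq> (\<Union>b\<in>?N. S \<inter> b)"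
  proof
    fix x assume "x \<in> {x \<in> space \<mu>. x \<notin> measure_support (top_of_set S) \<mu>}"
    then obtain U where U: "openin (top_of_set S) U" "x \<in> U" "emeasure \<mu> U = 0" "x \<in> S"
      by (auto simp: measure_support_def \<mu> not_gr_zero)
    then obtain V where V: "open V" "U = S \<inter> V" by (auto simp: openin_open)
    with U obtain b where b: "b \<in> B" "x \<in> b" "b \<subseteq> V"
      using topological_basisE[OF B(2) V(1), of x] by auto
    have "emeasure \<mu> (S \<inter> b) \<le> emeasure \<mu> U"
      using b V(1) by (intro emeasure_mono) (auto simp: V(2) open_sets)
    with U b show "x \<in> (\<Union>b\<in>?N. S \<inter> b)" by auto
  qed
  ultimately show ?thesis by (rule AE_I')
qed

section \<open>Existence of stationary measures for discrete random walks\<close>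

text \<open>Weak compactness on a continuous image of an interval. Lifting each law to the interval gives a
  tight sequence of distributions on the real line, Helly selection yields a weakly convergent
  subsequence, and the limit is pushed back by \<open>\<phi>\<close>. The lift \<open>\<sigma>\<close> is an arbitrary choice of
  preimages, which is harmless because the laws are discrete.\<close>

lemma pmf_seq_weak_limit:
  fixes \<phi> :: "real \<Rightarrow> 'a"
  assumes \<phi>: "continuous_map euclideanreal T \<phi>" and range: "range \<phi> = \<phi> ` {a..b}"
    and range_meas: "range \<phi> \<in> sets (borel_of T)"
    and c: "\<And>n :: nat. set_pmf (c n) \<subseteq> range \<phi>"
  obtains r \<nu> where "strict_mono (r :: nat \<Rightarrow> nat)" "borel_prob_measure T \<nu>" "AE x in \<nu>. x \<in> range \<phi>"
    "\<And>f B. continuous_map T euclideanreal f \<Longrightarrow> (\<And>x. \<bar>f x\<bar> \<le> B) \<Longrightarrow>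
      (\<lambda>n. \<integral>x. f x \<partial>c (r n)) \<longlonglongrightarrow> integral\<^sup>L \<nu> f"
proof -
  define \<sigma> where "\<sigma> x = (SOME t. t \<in> {a..b} \<and> \<phi> t = x)" for x
  have \<sigma>: "\<sigma> x \<in> {a..b} \<and> \<phi> (\<sigma> x) = x" if "x \<in> range \<phi>" for x
  proof -
    have "\<exists>t. t \<in> {a..b} \<and> \<phi> t = x" using that unfolding range by auto
    then show ?thesis unfolding \<sigma>_def by (rule someI_ex)
  qed
  define m where "m n = distr (measure_pmf (c n)) borel \<sigma>" for n
  have rd: "real_distribution (m n)" for n
    unfolding m_def by (rule prob_space.real_distribution_distr[OF prob_space_measure_pmf]) simp
  have "tight m"
    unfolding tight_def
  proof (intro conjI allI impI rd exI)
    show "a - 1 < b + 1" using range by (cases "a \<le> b") auto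
    fix \<epsilon> :: real and n assume "\<epsilon> > 0"
    have "measure (m n) {a - 1<..b + 1} = measure (c n) (\<sigma> -` {a - 1<..b + 1})"
      unfolding m_def by (subst measure_distr) auto
    also have "\<dots> = 1"
    proof -
      have "AE x in c n. x \<in> \<sigma> -` {a - 1<..b + 1}"
      proof (rule AE_pmfI)
        fix x assume "x \<in> set_pmf (c n)"
        then have "\<sigma> x \<in> {a..b}" using c \<sigma> by blast
        then show "x \<in> \<sigma> -` {a - 1<..b + 1}" by auto
      qed
      then show ?thesis by (subst measure_pmf.prob_eq_1) auto
    qed
    finally show "1 - \<epsilon> < measure (m n) {a - 1<..b + 1}" using \<open>\<epsilon> > 0\<close> by simp
  qed
  from tight_imp_convergent_subsubsequence[OF this strict_mono_id]
  obtain r M where r: "strict_mono (r :: nat \<Rightarrow> nat)" and M: "real_distribution M"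
    and weak: "weak_conv_m (\<lambda>n. m (r n)) M" by (auto simp: o_def)
  interpret M: real_distribution M by (rule M)
  define \<nu> where "\<nu> = distr M (borel_of T) \<phi>"
  have meas: "\<phi> \<in> M \<rightarrow>\<^sub>M borel_of T"
    using measurable_borel_of[OF \<phi>] by (simp cong: measurable_cong_sets add: sets_borel_of_euclidean)
  have \<nu>: "borel_prob_measure T \<nu>"
    unfolding \<nu>_def by (rule borel_prob_measure_distr[OF M.prob_space_axioms meas])
  have AE: "AE x in \<nu>. x \<in> range \<phi>"
  proof -
    have "{x \<in> space (borel_of T). x \<in> range \<phi>} = range \<phi>"
      using sets.sets_into_space[OF range_meas] by auto
    with range_meas show ?thesis
      unfolding \<nu>_def by (subst AE_distr_iff[OF meas]) auto
  qed
  have lim: "(\<lambda>n. \<integral>x. f x \<partial>c (r n)) \<longlonglongrightarrow> integral\<^sup>L \<nu> f"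
    if f: "continuous_map T euclideanreal f" and B: "\<And>x. \<bar>f x\<bar> \<le> B" for f B
  proof -
    have "continuous_map euclideanreal euclideanreal (f \<circ> \<phi>)"
      by (rule continuous_map_compose[OF \<phi> f])
    then have cont: "continuous_on UNIV (\<lambda>t. f (\<phi> t))" by (simp add: o_def)
    have "(\<lambda>n. \<integral>t. f (\<phi> t) \<partial>m (r n)) \<longlonglongrightarrow> (\<integral>t. f (\<phi> t) \<partial>M)"
      by (rule weak_conv_imp_integral_bdd_continuous_conv[OF rd M weak, where B = B])
        (use cont B in \<open>auto simp: continuous_on_eq_continuous_at\<close>)
    moreover have "(\<integral>t. f (\<phi> t) \<partial>m n) = (\<integral>x. f x \<partial>c n)" for n
    proof -
      have "(\<integral>t. f (\<phi> t) \<partial>m n) = (\<integral>x. f (\<phi> (\<sigma> x)) \<partial>c n)"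
        unfolding m_def
        by (rule integral_distr) (use borel_measurable_continuous_onI[OF cont] in auto)
      also have "\<dots> = (\<integral>x. f x \<partial>c n)"
      proof (rule integral_cong_AE)
        show "AE x in c n. f (\<phi> (\<sigma> x)) = f x"
        proof (rule AE_pmfI)
          fix x assume "x \<in> set_pmf (c n)"
          then have "\<phi> (\<sigma> x) = x" using c \<sigma> by blast
          then show "f (\<phi> (\<sigma> x)) = f x" by simp
        qed
      qed simp_all
      finally show ?thesis .
    qed
    moreover have "(\<integral>t. f (\<phi> t) \<partial>M) = integral\<^sup>L \<nu> f"
      unfolding \<nu>_def by (rule integral_distr[symmetric, OF meas borel_measurable_borel_of[OF f]])
    ultimately show ?thesis by simp
  qed
  show ?thesis by (rule that[OF r \<nu> AE lim])
qed

text \<open>The law after \<open>n\<close> steps of the random walk that starts at \<open>x\<close> and applies independent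
  \<open>M\<close>-distributed group elements.\<close>

primrec walk :: "'g pmf \<Rightarrow> ('g \<Rightarrow> 'a \<Rightarrow> 'a) \<Rightarrow> 'a \<Rightarrow> nat \<Rightarrow> 'a pmf" where
  "walk M act x 0 = return_pmf x"
| "walk M act x (Suc n) = bind_pmf M (\<lambda>g. map_pmf (act g) (walk M act x n))"

definition walk_average :: "'g pmf \<Rightarrow> ('g \<Rightarrow> 'a \<Rightarrow> 'a) \<Rightarrow> 'a \<Rightarrow> nat \<Rightarrow> 'a pmf" where
  "walk_average M act x n = bind_pmf (pmf_of_set {..n}) (walk M act x)"

lemma set_walk:
  assumes "\<And>g y. g \<in> set_pmf M \<Longrightarrow> y \<in> C \<Longrightarrow> act g y \<in> C" "x \<in> C"
  shows "set_pmf (walk M act x n) \<subseteq> C"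
  by (induction n) (use assms in \<open>auto\<close>)

text \<open>Taking one more step shifts the time average by one, because independent choices of the time and of
  the group element commute.\<close>

lemma walk_average_shift:
  "bind_pmf M (\<lambda>g. map_pmf (act g) (walk_average M act x n))
    = bind_pmf (pmf_of_set {..n}) (\<lambda>k. walk M act x (Suc k))"
  unfolding walk_average_def map_bind_pmf by (subst bind_commute_pmf) simp

lemma integral_bind_pmf:
  fixes f :: "'b \<Rightarrow> real"
  assumes "\<And>x. \<bar>f x\<bar> \<le> B"
  shows "(\<integral>x. f x \<partial>bind_pmf M N) = (\<integral>x. (\<integral>y. f y \<partial>N x) \<partial>M)"
  unfolding measure_pmf_bind
  by (rule integral_bind[where K = "count_space UNIV" and B = B and B' = 1])
    (auto simp: assms measure_pmf.finite_measure measure_pmf.emeasure_space_1[simplified]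
      measure_pmf_in_subprob_algebra)

text \<open>The difference between a time average and its shift telescopes: only the first and the last law
  remain, with weight \<open>1 / (n + 1)\<close> each.\<close>

lemma walk_average_almost_invariant:
  fixes M :: "'g pmf" and f :: "'a \<Rightarrow> real"
  assumes B: "\<And>x. \<bar>f x\<bar> \<le> B"
  shows "\<bar>(\<integral>g. (\<integral>y. f (act g y) \<partial>walk_average M act x n) \<partial>M) - (\<integral>y. f y \<partial>walk_average M act x n)\<bar>
    \<le> 2 * B / real (Suc n)"
proof -
  let ?E = "\<lambda>k. \<integral>y. f y \<partial>walk M act x k"
  have avg: "(\<integral>y. f y \<partial>bind_pmf (pmf_of_set {..n}) q) = (\<Sum>k\<le>n. \<integral>y. f y \<partial>q k) / real (Suc n)" for q
    by (subst integral_bind_pmf[OF B]) (simp add: integral_pmf_of_set)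
  have "(\<integral>g. (\<integral>y. f (act g y) \<partial>walk_average M act x n) \<partial>M)
    = (\<integral>y. f y \<partial>bind_pmf M (\<lambda>g. map_pmf (act g) (walk_average M act x n)))"
    by (subst integral_bind_pmf[OF B]) simp
  also have "\<dots> = (\<Sum>k\<le>n. ?E (Suc k)) / real (Suc n)"
    by (simp only: walk_average_shift avg)
  finally have "(\<integral>g. (\<integral>y. f (act g y) \<partial>walk_average M act x n) \<partial>M) - (\<integral>y. f y \<partial>walk_average M act x n)
    = (\<Sum>k\<le>n. ?E (Suc k) - ?E k) / real (Suc n)"
    by (simp add: walk_average_def avg sum_subtractf diff_divide_distrib)
  also have "(\<Sum>k\<le>n. ?E (Suc k) - ?E k) = ?E (Suc n) - ?E 0"
    using sum_lessThan_telescope[of ?E "Suc n"] by (simp only: lessThan_Suc_atMost)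
  finally have *: "(\<integral>g. (\<integral>y. f (act g y) \<partial>walk_average M act x n) \<partial>M) - (\<integral>y. f y \<partial>walk_average M act x n)
    = (?E (Suc n) - ?E 0) / real (Suc n)" .
  have bound: "\<bar>?E k\<bar> \<le> B" for k
  proof -
    have "\<bar>?E k\<bar> \<le> (\<integral>y. \<bar>f y\<bar> \<partial>walk M act x k)" by (rule integral_abs_bound)
    also have "\<dots> \<le> (\<integral>y. B \<partial>walk M act x k)"
      by (intro integral_mono measure_pmf.integrable_const_bound[where B = B]) (auto simp: B order_trans[OF abs_ge_zero B])
    finally show ?thesis by simp
  qed
  have "\<bar>?E (Suc n) - ?E 0\<bar> \<le> 2 * B" using bound[of "Suc n"] bound[of 0] by linarith
  then show ?thesis unfolding * by (simp add: divide_right_mono del: of_nat_Suc)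
qed

text \<open>The measure \<open>\<integral> g\<^sub>* \<nu> dM(g)\<close>. Outside the support of \<open>M\<close>, where \<open>act g\<close> may fail to be
  measurable, the integrand is set to \<open>\<nu>\<close> so as to be a probability kernel everywhere.\<close>

definition convolution :: "'g pmf \<Rightarrow> ('g \<Rightarrow> 'a \<Rightarrow> 'a) \<Rightarrow> 'a topology \<Rightarrow> 'a measure \<Rightarrow> 'a measure" where
  "convolution M act T \<nu> = measure_pmf M \<bind>
     (\<lambda>g. if g \<in> set_pmf M then distr \<nu> (borel_of T) (act g) else \<nu>)"

context
  fixes M :: "'g pmf" and act :: "'g \<Rightarrow> 'a \<Rightarrow> 'a" and T :: "'a topology" and \<nu> :: "'a measure"
  assumes cont: "\<And>g. g \<in> set_pmf M \<Longrightarrow> continuous_map T T (act g)"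
    and \<nu>: "borel_prob_measure T \<nu>"
begin

lemma act_measurable: "g \<in> set_pmf M \<Longrightarrow> act g \<in> \<nu> \<rightarrow>\<^sub>M borel_of T"
  using measurable_borel_of[OF cont] by (simp cong: measurable_cong_sets add: borel_prob_measureD[OF \<nu>])

lemma kernel: "(\<lambda>g. if g \<in> set_pmf M then distr \<nu> (borel_of T) (act g) else \<nu>)
    \<in> measure_pmf M \<rightarrow>\<^sub>M subprob_algebra (borel_of T)"
  using act_measurable borel_prob_measureD[OF \<nu>]
  by (auto simp: space_subprob_algebra split: if_splits
      intro!: prob_space_imp_subprob_space prob_space.prob_space_distr)

lemma emeasure_convolution:
  assumes "A \<in> sets (borel_of T)"
  shows "emeasure (convolution M act T \<nu>) A
    = (\<integral>\<^sup>+g. emeasure (distr \<nu> (borel_of T) (act g)) A \<partial>M)"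
  unfolding convolution_def
  by (subst emeasure_bind[OF _ kernel assms]) (auto intro!: nn_integral_cong_AE AE_pmfI)

lemma borel_prob_measure_convolution: "borel_prob_measure T (convolution M act T \<nu>)"
  unfolding borel_prob_measure_def convolution_def
proof
  show "prob_space (measure_pmf M \<bind> (\<lambda>g. if g \<in> set_pmf M then distr \<nu> (borel_of T) (act g) else \<nu>))"
    by (rule measure_pmf.prob_space_bind[OF _ kernel], rule AE_pmfI)
      (use act_measurable borel_prob_measureD[OF \<nu>] in \<open>auto intro!: prob_space.prob_space_distr\<close>)
qed (rule sets_bind, use sets_kernel[OF kernel] in auto)

lemma integral_convolution:
  fixes f :: "'a \<Rightarrow> real"
  assumes f: "f \<in> borel_measurable (borel_of T)" "\<And>x. \<bar>f x\<bar> \<le> B"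
  shows "integral\<^sup>L (convolution M act T \<nu>) f = (\<integral>g. (\<integral>x. f (act g x) \<partial>\<nu>) \<partial>M)"
proof -
  have 1: "emeasure (if g \<in> set_pmf M then distr \<nu> (borel_of T) (act g) else \<nu>)
      (space (if g \<in> set_pmf M then distr \<nu> (borel_of T) (act g) else \<nu>)) \<le> 1" for g
    using subprob_space.emeasure_space_le_1[of "if g \<in> set_pmf M then distr \<nu> (borel_of T) (act g) else \<nu>"]
      measurable_space[OF kernel, of g] by (simp add: space_subprob_algebra)
  have "integral\<^sup>L (convolution M act T \<nu>) f
    = (\<integral>g. integral\<^sup>L (if g \<in> set_pmf M then distr \<nu> (borel_of T) (act g) else \<nu>) f \<partial>M)"
    unfolding convolution_def
    by (rule integral_bind[where B = B and B' = 1, OF f(1) f(2) kernel])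
      (use 1 in \<open>auto simp: measure_pmf.finite_measure\<close>)
  also have "\<dots> = (\<integral>g. (\<integral>x. f (act g x) \<partial>\<nu>) \<partial>M)"
    by (rule integral_cong_AE) (auto intro!: AE_pmfI integral_distr act_measurable f(1))
  finally show ?thesis .
qed

lemma stationary_if_convolution_eq:
  assumes \<mu>: "\<And>F :: 'g \<Rightarrow> ennreal. (\<integral>\<^sup>+g. F g \<partial>\<mu>) = (\<integral>\<^sup>+g. F g \<partial>M)"
    and eq: "convolution M act T \<nu> = \<nu>"
  shows "stationary \<mu> act T \<nu>"
  using emeasure_convolution by (simp add: stationary_def \<nu> \<mu> eq)

end

text \<open>The Krylov-Bogoliubov argument. A weak limit \<open>\<nu>\<close> of the time averages of the walk is stationary,
  because \<open>f\<close> and its average over one more step have asymptotically equal integrals. The limit is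
  exchanged with the integral over \<open>g\<close> by dominated convergence, each \<open>f \<circ> act g\<close> being itself an
  admissible test function.\<close>

lemma exists_stationary_measure:
  fixes F :: "'a \<Rightarrow> 'b::metric_space" and \<phi> :: "real \<Rightarrow> 'a" and M :: "'g pmf" and act :: "'g \<Rightarrow> 'a \<Rightarrow> 'a"
  assumes F: "continuous_map T euclidean F" "inj_on F (topspace T)"
    and \<phi>: "continuous_map euclideanreal T \<phi>" and range: "range \<phi> = \<phi> ` {a..b}"
    and cont: "\<And>g. g \<in> set_pmf M \<Longrightarrow> continuous_map T T (act g)"
    and invariant: "\<And>g x. g \<in> set_pmf M \<Longrightarrow> x \<in> range \<phi> \<Longrightarrow> act g x \<in> range \<phi>"
  obtains \<nu> where "borel_prob_measure T \<nu>" "AE x in \<nu>. x \<in> range \<phi>" "convolution M act T \<nu> = \<nu>"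
proof -
  have K: "compactin T (range \<phi>)"
    unfolding range by (rule image_compactin[OF _ \<phi>]) simp
  have closed: "range \<phi> \<in> sets (borel_of T)"
  proof (rule closedin_borel_of)
    have "Hausdorff_space T" by (rule Hausdorff_space_injective_preimage[OF _ F]) simp
    then show "closedin T (range \<phi>)" using K by (rule compactin_imp_closedin)
  qed
  let ?c = "walk_average M act (\<phi> 0)"
  have "set_pmf (?c n) \<subseteq> range \<phi>" for n
    using set_walk[where M = M and act = act and C = "range \<phi>" and x = "\<phi> 0", OF invariant] by (fastforce simp: walk_average_def)
  then obtain r \<nu> where r: "strict_mono r" and \<nu>: "borel_prob_measure T \<nu>" "AE x in \<nu>. x \<in> range \<phi>"
    and lim: "\<And>f B. continuous_map T euclideanreal f \<Longrightarrow> (\<And>x. \<bar>f x\<bar> \<le> B) \<Longrightarrow>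
      (\<lambda>n. \<integral>x. f x \<partial>?c (r n)) \<longlonglongrightarrow> integral\<^sup>L \<nu> f"
    using pmf_seq_weak_limit[OF \<phi> range closed, of ?c] by metis
  have "convolution M act T \<nu> = \<nu>"
  proof (rule borel_prob_measure_eqI_continuous[OF F K _ _ \<nu>])
    show conv: "borel_prob_measure T (convolution M act T \<nu>)"
      by (rule borel_prob_measure_convolution[OF cont \<nu>(1)])
    interpret C: prob_space "convolution M act T \<nu>" using conv by (rule borel_prob_measureD)
    interpret N: prob_space \<nu> using \<nu>(1) by (rule borel_prob_measureD)
    have "emeasure (convolution M act T \<nu>) (range \<phi>)
        = (\<integral>\<^sup>+g. emeasure (distr \<nu> (borel_of T) (act g)) (range \<phi>) \<partial>M)"
      by (rule emeasure_convolution[OF cont \<nu>(1) closed])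
    also have "\<dots> = (\<integral>\<^sup>+g. 1 \<partial>M)"
    proof (rule nn_integral_cong_AE, rule AE_pmfI)
      fix g assume g: "g \<in> set_pmf M"
      have act: "act g \<in> \<nu> \<rightarrow>\<^sub>M borel_of T" by (rule act_measurable[OF cont \<nu>(1) g])
      have "AE x in \<nu>. x \<in> act g -` range \<phi> \<inter> space \<nu>"
        using \<nu>(2) AE_space by eventually_elim (use invariant[OF g] in auto)
      then have "emeasure \<nu> (act g -` range \<phi> \<inter> space \<nu>) = 1"
        by (intro N.emeasure_eq_1_AE measurable_sets[OF act closed])
      then show "emeasure (distr \<nu> (borel_of T) (act g)) (range \<phi>) = 1"
        by (simp add: emeasure_distr[OF act closed])
    qed
    finally have "C.prob (range \<phi>) = 1" by (simp add: C.emeasure_eq_measure)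
    then show "AE x in convolution M act T \<nu>. x \<in> range \<phi>"
      using C.prob_eq_1[of "range \<phi>"] closed by (simp add: borel_prob_measureD[OF conv])
    fix f :: "'a \<Rightarrow> real" assume f: "continuous_map T euclidean f" "\<And>x. \<bar>f x\<bar> \<le> 1"
    have "(\<lambda>n. \<integral>g. (\<integral>x. f (act g x) \<partial>?c (r n)) \<partial>M) \<longlonglongrightarrow> (\<integral>g. (\<integral>x. f (act g x) \<partial>\<nu>) \<partial>M)"
    proof (rule integral_dominated_convergence[where w = "\<lambda>_. 1"])
      show "AE g in M. (\<lambda>n. \<integral>x. f (act g x) \<partial>?c (r n)) \<longlonglongrightarrow> (\<integral>x. f (act g x) \<partial>\<nu>)"
      proof (rule AE_pmfI)
        fix g assume "g \<in> set_pmf M"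
        then have "continuous_map T euclideanreal (\<lambda>x. f (act g x))"
          using continuous_map_compose[OF cont f(1)] by (simp add: o_def)
        then show "(\<lambda>n. \<integral>x. f (act g x) \<partial>?c (r n)) \<longlonglongrightarrow> (\<integral>x. f (act g x) \<partial>\<nu>)"
          by (rule lim) (rule f(2))
      qed
      show "AE g in M. norm (\<integral>x. f (act g x) \<partial>?c (r n)) \<le> 1" for n
      proof (intro AE_pmfI)
        fix g
        have "norm (\<integral>x. f (act g x) \<partial>?c (r n)) \<le> (\<integral>x. norm (f (act g x)) \<partial>?c (r n))"
          by (rule integral_norm_bound)
        also have "\<dots> \<le> (\<integral>x. 1 \<partial>?c (r n))"
          by (intro integral_mono measure_pmf.integrable_const_bound[where B = 1]) (auto simp: f(2))
        finally show "norm (\<integral>x. f (act g x) \<partial>?c (r n)) \<le> 1" by simp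
      qed
    qed auto
    moreover have "(\<lambda>n. (\<integral>g. (\<integral>x. f (act g x) \<partial>?c (r n)) \<partial>M) - (\<integral>x. f x \<partial>?c (r n))) \<longlonglongrightarrow> 0"
    proof (rule Lim_null_comparison)
      show "eventually (\<lambda>n. norm ((\<integral>g. (\<integral>x. f (act g x) \<partial>?c (r n)) \<partial>M) - (\<integral>x. f x \<partial>?c (r n)))
          \<le> 2 * 1 / real (Suc (r n))) sequentially"
        unfolding real_norm_def by (intro always_eventually allI walk_average_almost_invariant f(2))
      have "(\<lambda>n. 2 * 1 / real (Suc n)) \<longlonglongrightarrow> 0"
        using tendsto_mult_right_zero[OF LIMSEQ_inverse_real_of_nat, of 2] by (simp add: divide_inverse)
      then show "(\<lambda>n. 2 * 1 / real (Suc (r n))) \<longlonglongrightarrow> 0"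
        using LIMSEQ_subseq_LIMSEQ[OF _ r] by (fastforce simp: o_def)
    qed
    ultimately have "(\<lambda>n. \<integral>x. f x \<partial>?c (r n)) \<longlonglongrightarrow> (\<integral>g. (\<integral>x. f (act g x) \<partial>\<nu>) \<partial>M)"
      using tendsto_diff by fastforce
    then have "(\<integral>g. (\<integral>x. f (act g x) \<partial>\<nu>) \<partial>M) = integral\<^sup>L \<nu> f"
      using lim[OF f] by (rule LIMSEQ_unique)
    then show "integral\<^sup>L (convolution M act T \<nu>) f = integral\<^sup>L \<nu> f"
      by (simp add: integral_convolution[OF cont \<nu>(1) borel_measurable_borel_of[OF f(1)] f(2)])
  qed
  with \<nu> that show ?thesis by blast
qed

section \<open>Pushing the Furstenberg measure forward along the section\<close>

lemma isotropic_planes_sets: "isotropic_planes \<in> sets (borel_of Gr2_top)"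
  by (intro closedin_borel_of compactin_imp_closedin Hausdorff_Gr2_top compactin_isotropic_planes)

lemma AE_in_Gamma0:
  assumes "borel_prob_measure SL3_top \<mu>" "generate SL3 (measure_support SL3_top \<mu>) = Gamma0"
  shows "AE g in \<mu>. g \<in> Gamma0"
  using AE_in_measure_support[OF assms(1)[unfolded SL3_top_def]]
  by eventually_elim (use assms(2) generate.incl in \<open>fastforce simp: SL3_top_def\<close>)

lemma Gamma0_pmf:
  assumes \<mu>: "borel_prob_measure SL3_top \<mu>" "generate SL3 (measure_support SL3_top \<mu>) = Gamma0"
  obtains M where "set_pmf M \<subseteq> Gamma0"
    "\<And>F :: _ \<Rightarrow> ennreal. (\<integral>\<^sup>+g. F g \<partial>\<mu>) = (\<integral>\<^sup>+g. F g \<partial>M)"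
proof (rule countable_support_pmf[OF _ countable_Gamma0 _ AE_in_Gamma0[OF \<mu>]])
  show "prob_space \<mu>" using \<mu>(1) by (rule borel_prob_measureD)
  fix g assume "g \<in> Gamma0"
  then have "closedin SL3_top {g}"
    unfolding SL3_top_def using Gamma0_subset_SL3 by (intro closed_subset) auto
  then show "{g} \<in> sets \<mu>" by (simp add: borel_prob_measureD[OF \<mu>(1)] closedin_borel_of)
qed (use that in blast)

text \<open>The isotropic planes form an invariant continuous image of an interval, so they carry a stationary
  measure. By uniqueness it is the Furstenberg measure.\<close>

lemma furstenberg_measure_isotropic:
  assumes \<mu>: "borel_prob_measure SL3_top \<mu>" "generate SL3 (measure_support SL3_top \<mu>) = Gamma0"
    and \<nu>: "furstenberg_measure \<mu> \<nu>"
  shows "AE p in \<nu>. p \<in> isotropic_planes"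
proof -
  obtain M where M: "set_pmf M \<subseteq> Gamma0"
    "\<And>F :: _ \<Rightarrow> ennreal. (\<integral>\<^sup>+g. F g \<partial>\<mu>) = (\<integral>\<^sup>+g. F g \<partial>M)"
    using Gamma0_pmf[OF \<mu>] by blast
  have range: "range circle_plane = isotropic_planes"
    using circle_plane_in_isotropic_planes circle_plane_image by blast
  have cont: "continuous_map Gr2_top Gr2_top (Gr2_act g)" if "g \<in> set_pmf M" for g
    using that M(1) Gamma0_subset_SL3 by (intro continuous_map_Gr2_act) auto
  obtain \<nu>' where \<nu>': "borel_prob_measure Gr2_top \<nu>'" "AE p in \<nu>'. p \<in> range circle_plane"
      "convolution M Gr2_act Gr2_top \<nu>' = \<nu>'"
  proof (rule exists_stationary_measure[where T = Gr2_top and M = M and act = Gr2_act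
      and \<phi> = circle_plane and a = 0 and b = "2 * pi"])
    show "continuous_map Gr2_top euclidean plane_projection" by (rule continuous_map_plane_projection)
    show "inj_on plane_projection (topspace Gr2_top)" by (simp add: inj_on_plane_projection)
    show "continuous_map euclideanreal Gr2_top circle_plane" by (rule continuous_map_circle_plane)
    show "range circle_plane = circle_plane ` {0..2 * pi}" by (simp add: range circle_plane_image)
    show "Gr2_act g p \<in> range circle_plane" if "g \<in> set_pmf M" "p \<in> range circle_plane" for g p
      using that M(1) Gamma0_equivariant(1) unfolding range by blast
  qed (use cont in auto)
  have "stationary \<mu> Gr2_act Gr2_top \<nu>'"
    by (rule stationary_if_convolution_eq[OF cont \<nu>'(1) M(2) \<nu>'(3)])
  then have "\<nu>' = \<nu>" using \<nu> by (simp add: furstenberg_measure_def)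
  then show ?thesis using \<nu>'(2) unfolding range by (rule subst)
qed

lemma iso_section_measurable:
  assumes "sets \<nu> = sets (borel_of Gr2_top)"
  shows "iso_section \<in> restrict_space \<nu> isotropic_planes \<rightarrow>\<^sub>M borel_of X_top"
proof (rule measurable_sigma_sets[OF sets_borel_of])
  have space: "space (restrict_space \<nu> isotropic_planes) = isotropic_planes"
    using sets_eq_imp_space_eq[OF assms] isotropic_planes_subset_Gr2 by (auto simp: space_restrict_space)
  have top: "topspace (subtopology Gr2_top isotropic_planes) = isotropic_planes"
    using isotropic_planes_subset_Gr2 by auto
  show "iso_section \<in> space (restrict_space \<nu> isotropic_planes) \<rightarrow> topspace X_top"
    using continuous_map_iso_section unfolding continuous_map_def space top by blast
  fix U assume "U \<in> {U. openin X_top U}"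
  then have "openin (subtopology Gr2_top isotropic_planes) {p \<in> isotropic_planes. iso_section p \<in> U}"
    using continuous_map_iso_section unfolding continuous_map_def top by blast
  then obtain V where V: "openin Gr2_top V" "{p \<in> isotropic_planes. iso_section p \<in> U} = V \<inter> isotropic_planes"
    by (auto simp: openin_subtopology)
  have "iso_section -` U \<inter> isotropic_planes = isotropic_planes \<inter> V" using V(2) by auto
  then show "iso_section -` U \<inter> space (restrict_space \<nu> isotropic_planes)
      \<in> sets (restrict_space \<nu> isotropic_planes)"
    using openin_borel_of[OF V(1)] by (auto simp: space sets_restrict_space assms)
qed (use openin_subset in blast)

context
  fixes \<nu> :: "(real^3) set measure"
  assumes \<nu>: "borel_prob_measure Gr2_top \<nu>" and AE: "AE p in \<nu>. p \<in> isotropic_planes"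
begin

interpretation prob_space \<nu> using \<nu> by (rule borel_prob_measureD)

lemma sets_isotropic: "isotropic_planes \<in> sets \<nu>"
  by (simp add: borel_prob_measureD[OF \<nu>] isotropic_planes_sets)

lemma space_restrict_isotropic: "space (restrict_space \<nu> isotropic_planes) = isotropic_planes"
  using isotropic_planes_subset_Gr2 by (auto simp: space_restrict_space borel_prob_measureD[OF \<nu>])

lemma measurable_iso_section: "iso_section \<in> restrict_space \<nu> isotropic_planes \<rightarrow>\<^sub>M borel_of X_top"
  by (rule iso_section_measurable) (simp add: borel_prob_measureD[OF \<nu>])

lemma vimage_iso_section_sets:
  assumes "A \<in> sets (borel_of X_top)"
  shows "iso_section -` A \<inter> isotropic_planes \<in> sets \<nu>"
  using measurable_sets[OF measurable_iso_section assms] sets_isotropic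
  by (simp add: space_restrict_isotropic sets_restrict_space_iff Int_absorb2 sets.Int_space_eq2)

lemma emeasure_push_section:
  assumes "A \<in> sets (borel_of X_top)"
  shows "emeasure (push_section iso_section \<nu>) A = emeasure \<nu> (iso_section -` A \<inter> isotropic_planes)"
  unfolding push_section_def
  using sets_isotropic
  by (simp add: emeasure_distr[OF measurable_iso_section assms] space_restrict_isotropic
      emeasure_restrict_space sets.Int_space_eq2)

lemma borel_prob_measure_push_section: "borel_prob_measure X_top (push_section iso_section \<nu>)"
  unfolding push_section_def
  by (rule borel_prob_measure_distr[OF _ measurable_iso_section])
    (rule prob_space_restrict_space[OF sets_isotropic emeasure_eq_1_AE[OF sets_isotropic AE]])

text \<open>By equivariance, for \<open>g \<in> \<Gamma>\<^sub>0\<close> the translate of the pushforward by \<open>g\<close> gives a set \<open>A\<close> the mass that the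
  translate of \<open>\<nu>\<close> gives to its preimage under the section; integrating over \<open>g\<close> reduces stationarity
  upstairs to stationarity of \<open>\<nu>\<close>.\<close>

lemma stationary_push_section:
  assumes \<mu>: "AE g in \<mu>. g \<in> Gamma0" and stat: "stationary \<mu> Gr2_act Gr2_top \<nu>"
  shows "stationary \<mu> X_act X_top (push_section iso_section \<nu>)"
  unfolding stationary_def
proof (intro conjI ballI borel_prob_measure_push_section)
  note push = borel_prob_measureD[OF borel_prob_measure_push_section]
  fix A assume A: "A \<in> sets (borel_of X_top)"
  let ?B = "iso_section -` A \<inter> isotropic_planes"
  have B: "?B \<in> sets (borel_of Gr2_top)"
    using vimage_iso_section_sets[OF A] by (simp add: borel_prob_measureD[OF \<nu>])
  have "emeasure (distr (push_section iso_section \<nu>) (borel_of X_top) (X_act g)) A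
      = emeasure (distr \<nu> (borel_of Gr2_top) (Gr2_act g)) ?B" if g: "g \<in> Gamma0" for g
  proof -
    have det: "det g = 1" using g Gamma0_subset_SL3 by auto
    have X: "X_act g \<in> push_section iso_section \<nu> \<rightarrow>\<^sub>M borel_of X_top"
      using measurable_borel_of[OF continuous_map_X_act[OF det]] by (simp cong: measurable_cong_sets add: push)
    have Gr: "Gr2_act g \<in> \<nu> \<rightarrow>\<^sub>M borel_of Gr2_top"
      using measurable_borel_of[OF continuous_map_Gr2_act[OF det]]
      by (simp cong: measurable_cong_sets add: borel_prob_measureD[OF \<nu>])
    have gA: "X_act g -` A \<inter> space (push_section iso_section \<nu>) \<in> sets (borel_of X_top)"
      using measurable_sets[OF X A] by (simp add: push)
    have "emeasure (distr (push_section iso_section \<nu>) (borel_of X_top) (X_act g)) A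
        = emeasure \<nu> (iso_section -` (X_act g -` A \<inter> space (push_section iso_section \<nu>)) \<inter> isotropic_planes)"
      by (simp only: emeasure_distr[OF X A] emeasure_push_section[OF gA])
    also have "\<dots> = emeasure \<nu> (Gr2_act g -` ?B \<inter> space \<nu>)"
    proof (rule emeasure_eq_AE)
      have section_in: "iso_section p \<in> X_space" if "p \<in> isotropic_planes" for p
        using measurable_space[OF measurable_iso_section] that
        by (simp add: space_restrict_isotropic)
      show "AE p in \<nu>. p \<in> iso_section -` (X_act g -` A \<inter> space (push_section iso_section \<nu>)) \<inter> isotropic_planes
          \<longleftrightarrow> p \<in> Gr2_act g -` ?B \<inter> space \<nu>"
        using AE AE_space
        by eventually_elim (simp add: Gamma0_equivariant[OF g] section_in push)
    qed (use vimage_iso_section_sets[OF gA] measurable_sets[OF Gr B] in auto)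
    also have "\<dots> = emeasure (distr \<nu> (borel_of Gr2_top) (Gr2_act g)) ?B"
      by (simp only: emeasure_distr[OF Gr B])
    finally show ?thesis .
  qed
  note push_eq = this
  have "(\<integral>\<^sup>+g. emeasure (distr (push_section iso_section \<nu>) (borel_of X_top) (X_act g)) A \<partial>\<mu>)
      = (\<integral>\<^sup>+g. emeasure (distr \<nu> (borel_of Gr2_top) (Gr2_act g)) ?B \<partial>\<mu>)"
  proof (rule nn_integral_cong_AE)
    show "AE g in \<mu>. emeasure (distr (push_section iso_section \<nu>) (borel_of X_top) (X_act g)) A
        = emeasure (distr \<nu> (borel_of Gr2_top) (Gr2_act g)) ?B"
      using \<mu> by eventually_elim (rule push_eq)
  qed
  also have "\<dots> = emeasure \<nu> ?B" using stat B by (simp add: stationary_def)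
  also have "\<dots> = emeasure (push_section iso_section \<nu>) A" by (simp add: emeasure_push_section[OF A])
  finally show "(\<integral>\<^sup>+g. emeasure (distr (push_section iso_section \<nu>) (borel_of X_top) (X_act g)) A \<partial>\<mu>)
      = emeasure (push_section iso_section \<nu>) A" .
qed

text \<open>The conditional measure over a plane \<open>p\<close> is the point mass at its value under the section.\<close>

lemma one_extension_push_section:
  "one_extension X_top Gr2_top X_proj (push_section iso_section \<nu>) \<nu>"
  unfolding one_extension_def
proof (intro conjI exI borel_prob_measure_push_section \<nu>)
  note push = borel_prob_measureD[OF borel_prob_measure_push_section]
  have proj_X: "X_proj \<in> borel_of X_top \<rightarrow>\<^sub>M borel_of Gr2_top"
    by (rule measurable_borel_of[OF continuous_map_X_proj])
  then have proj: "X_proj \<in> push_section iso_section \<nu> \<rightarrow>\<^sub>M borel_of Gr2_top"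
    by (simp cong: measurable_cong_sets add: push)
  have section_in: "iso_section p \<in> X_space" if "p \<in> isotropic_planes" for p
    using measurable_space[OF measurable_iso_section] that by (simp add: space_restrict_isotropic)
  show "distr (push_section iso_section \<nu>) (borel_of Gr2_top) X_proj = \<nu>"
  proof (rule measure_eqI)
    fix A assume "A \<in> sets (distr (push_section iso_section \<nu>) (borel_of Gr2_top) X_proj)"
    then have A: "A \<in> sets (borel_of Gr2_top)" by simp
    have pA: "X_proj -` A \<inter> space (push_section iso_section \<nu>) \<in> sets (borel_of X_top)"
      using measurable_sets[OF proj A] by (simp add: push)
    have "emeasure (distr (push_section iso_section \<nu>) (borel_of Gr2_top) X_proj) A
        = emeasure \<nu> (iso_section -` (X_proj -` A \<inter> space (push_section iso_section \<nu>)) \<inter> isotropic_planes)"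
      by (simp only: emeasure_distr[OF proj A] emeasure_push_section[OF pA])
    also have "\<dots> = emeasure \<nu> A"
    proof (rule emeasure_eq_AE)
      show "AE p in \<nu>. p \<in> iso_section -` (X_proj -` A \<inter> space (push_section iso_section \<nu>)) \<inter> isotropic_planes
          \<longleftrightarrow> p \<in> A"
        using AE by eventually_elim (simp add: section_in push X_proj_iso_section)
    qed (use vimage_iso_section_sets[OF pA] A in \<open>auto simp: borel_prob_measureD[OF \<nu>]\<close>)
    finally show "emeasure (distr (push_section iso_section \<nu>) (borel_of Gr2_top) X_proj) A = emeasure \<nu> A" .
  qed (simp add: borel_prob_measureD[OF \<nu>])
  \<comment> \<open>The section is extended to all planes by a constant; the new values matter only on a null set.\<close>
  let ?\<zeta> = "\<lambda>p. if p \<in> isotropic_planes then iso_section p else base_lattice"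
  have \<zeta>: "?\<zeta> \<in> \<nu> \<rightarrow>\<^sub>M borel_of X_top"
    by (rule measurable_If_restrict_space_iff[THEN iffD2])
      (use sets_isotropic measurable_iso_section base_lattice_in_X_space in
        \<open>auto simp: sets.Int_space_eq2\<close>)
  show "disintegration X_top X_proj (push_section iso_section \<nu>) \<nu> (\<lambda>p. return (borel_of X_top) (?\<zeta> p))"
    unfolding disintegration_def
  proof (intro conjI ballI)
    show "(\<lambda>p. return (borel_of X_top) (?\<zeta> p)) \<in> \<nu> \<rightarrow>\<^sub>M prob_algebra (borel_of X_top)"
      by (rule measurable_compose[OF \<zeta> measurable_return_prob_space])
    show "AE p in \<nu>. AE x in return (borel_of X_top) (?\<zeta> p). X_proj x = p"
      using AE
    proof eventually_elim
      fix p assume p: "p \<in> isotropic_planes"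
      \<comment> \<open>The fibre of the projection over a plane is a Borel set, as points of the Grassmannian are closed.\<close>
      have "closedin Gr2_top {p}"
        using p isotropic_planes_subset_Gr2 Hausdorff_Gr2_top by (intro closedin_Hausdorff_singleton) auto
      then have "{x \<in> space (borel_of X_top). X_proj x = p} \<in> sets (borel_of X_top)"
        using measurable_sets[OF proj_X closedin_borel_of, of "{p}"]
        by (simp add: vimage_def Int_def conj_commute)
      then show "AE x in return (borel_of X_top) (?\<zeta> p). X_proj x = p"
        using p by (subst AE_return) (auto simp: section_in X_proj_iso_section pred_def)
    qed
    fix A assume A: "A \<in> sets (borel_of X_top)"
    have "(\<integral>\<^sup>+p. emeasure (return (borel_of X_top) (?\<zeta> p)) A \<partial>\<nu>)
        = (\<integral>\<^sup>+p. indicator (iso_section -` A \<inter> isotropic_planes) p \<partial>\<nu>)"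
    proof (rule nn_integral_cong_AE)
      show "AE p in \<nu>. emeasure (return (borel_of X_top) (?\<zeta> p)) A
          = indicator (iso_section -` A \<inter> isotropic_planes) p"
        using AE by eventually_elim (simp add: A indicator_def)
    qed
    also have "\<dots> = emeasure (push_section iso_section \<nu>) A"
      by (simp add: vimage_iso_section_sets[OF A] emeasure_push_section[OF A])
    finally show "emeasure (push_section iso_section \<nu>) A
        = (\<integral>\<^sup>+p. emeasure (return (borel_of X_top) (?\<zeta> p)) A \<partial>\<nu>)" by simp
  qed
  show "AE p in \<nu>. \<exists>x\<in>topspace X_top. return (borel_of X_top) (?\<zeta> p) = return (borel_of X_top) x"
    using AE by eventually_elim (auto intro: section_in)
qed

end

theorem theorem1p10:
  "\<exists>\<zeta>. equivariant_section \<zeta> \<and>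
     (\<forall>\<mu> \<nu>. borel_prob_measure SL3_top \<mu> \<longrightarrow>
        generate SL3 (measure_support SL3_top \<mu>) = Gamma0 \<longrightarrow>
        furstenberg_measure \<mu> \<nu> \<longrightarrow>
        stationary \<mu> X_act X_top (push_section \<zeta> \<nu>) \<and>
        one_extension X_top Gr2_top X_proj (push_section \<zeta> \<nu>) \<nu>)"
proof (rule exI[of _ iso_section], intro conjI allI impI)
  show "equivariant_section iso_section" by (rule equivariant_section_iso_section)
next
  fix \<mu> :: "(real^3^3) measure" and \<nu> :: "(real^3) set measure"
  assume \<mu>: "borel_prob_measure SL3_top \<mu>" "generate SL3 (measure_support SL3_top \<mu>) = Gamma0"
    and \<nu>: "furstenberg_measure \<mu> \<nu>"
  have stat: "stationary \<mu> Gr2_act Gr2_top \<nu>" using \<nu> by (simp add: furstenberg_measure_def)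
  then have prob: "borel_prob_measure Gr2_top \<nu>" by (simp add: stationary_def)
  have AE: "AE p in \<nu>. p \<in> isotropic_planes"
    by (rule furstenberg_measure_isotropic[OF \<mu> \<nu>])
  show "stationary \<mu> X_act X_top (push_section iso_section \<nu>)"
    by (rule stationary_push_section[OF prob AE AE_in_Gamma0[OF \<mu>] stat])
  show "one_extension X_top Gr2_top X_proj (push_section iso_section \<nu>) \<nu>"
    by (rule one_extension_push_section[OF prob AE])
qed

end
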